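(* Let $E$ be a real Banach space and $F$ a real Hilbert space with a Schauder basis $(b_i)_{i\in\mathbb N}$ that is both Besselian and Hilbertian, with biorthogonal functionals $(b_i^* )_{i\in\mathbb N}$. Let $I_0=\mathbb N$ (so $I_1=\emptyset$: only equality constraints), let $f_0:E\to\mathbb R$ and $G:E\to F$ be of class $C^1$, $g_i:=b_i^*\circ G$, and $$\mathcal F=\{x\in E\mid g_i(x)=0,\ i\in I_0\}.$$ Let $x_0\in\mathcal F$ be a local minimizer of $f_0$ over $\mathcal F$. Assume that the Constant Rank Condition Plus (CRC+) holds for $(g_i)_{i\in I_0}$ at $x_0$ with a neighbourhood $V(x_0)$. Then the set of Lagrange multipliers at $x_0$ is nonempty, i.e. there exists $\lambda\in F$ with $Df_0(x_0)+DG(x_0)^*\lambda=0$.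
   Context: Schauder basis of a Banach space $X$: a sequence $(v_i)$ such that every $x\in X$ has a unique expansion $x=\sum_i a_iv_i$ (for finite-dimensional $X$, a linear basis); the biorthogonal functionals $v_i^*\in X^*$ satisfy $v_i^*(v_j)=\delta_{ij}$, $x=\sum_i v_i^*(x)v_i$. A basis $(c_i)$ is Besselian if convergence of $\sum_i\alpha_ic_i$ implies $\sum_i\alpha_i^2<\infty$, and Hilbertian if $\sum_i\alpha_i^2<\infty$ implies convergence of $\sum_i\alpha_ic_i$. It is boundedly-complete if $\sup_N\|\sum_{i\le N}a_iv_i\|<\infty$ implies convergence of $\sum a_iv_i$, and shrinking if $(v_i^* )$ is a basis of $X^*$. $\overline{\operatorname{span}}$ is the norm-closed linear span. The constraint cone is $K=\{0\}$, so $\mathcal F=\{x\mid G(x)\in K\}$ and the normal cone to $K$ at $G(x_0)=0$ is all of $F$. $DG(x_0)^*:F\to E^*$ is the adjoint of $DG(x_0)$. With the Lagrangian $L(x,\lambda)=f_0(x)+\langle\lambda\mid G(x)\rangle$, a Lagrange multiplier at $x_0$ is an element $\lambda$ of the normal cone to $K$ at $G(x_0)$ with $D_xL(x_0,\lambda)=0$. For $J=\{j_1<j_2<\dots\}\subset\mathbb N$: $Y(J)=\{(c_i)_{i\in J}\mid\sum_{i\in J}c_ib_i\text{ converges in }F\}$ with norm $\sup_N\|\sum_{k=1}^Nc_{j_k}b_{j_k}\|$. CRC+ holds for $(g_i)_{i\in I_0}$ at $x_0$ with neighbourhood $V(x_0)$ if there is $J_2\subset I_0$ such that: 1. $(Dg_i(x))_{i\in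 J_2}$ is a Schauder basis of $\overline{\operatorname{span}}(Dg_i(x),\,i\in I_0)\subset E^*$ for all $x\in V(x_0)$; 2. for every $x\in V(x_0)$ there is a (linear) topological isomorphism $z_x:\overline{\operatorname{span}}(Dg_i(x),i\in J_2)\to\overline{\operatorname{span}}(Dg_i(x_0),i\in J_2)$ with $z_x(Dg_i(x))=Dg_i(x_0)$, $i\in J_2$; 3. $(Dg_i(x_0))_{i\in J_2}(E)=\{(Dg_i(x_0)e)_{i\in J_2}\mid e\in E\}$ is closed in $Y(J_2)$; 4. $(Dg_i(x_0))_{i\in J_2}$ is a shrinking and boundedly-complete basis of $X_1:=\overline{\operatorname{span}}(Dg_i(x_0),i\in I_0)$; 5. $(Dg_i(x_0))_{i\in J_2}$ is Besselian for $X_1$; 6. $Dg_i(x_0)^*\in E$ for $i\in J_2$, where $Dg_i(x_0)^*\in X_1^*$ are the functionals biorthogonal to the basis $(Dg_i(x_0))_{i\in J_2}$ of $X_1$; i.e. each $Dg_i(x_0)^*$ is evaluation of elements of $X_1\subset E^*$ at an element of $E$. *)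

theory Defs
  imports "HOL-Analysis.Analysis"
begin

section \<open>Differential calculus\<close>

definition fderiv :: "('a::real_normed_vector \<Rightarrow> 'b::real_normed_vector) \<Rightarrow> 'a \<Rightarrow> 'a \<Rightarrow>\<^sub>L 'b"
  where "fderiv f x = Blinfun (frechet_derivative f (at x))"

definition class_C1 :: "('a::real_normed_vector \<Rightarrow> 'b::real_normed_vector) \<Rightarrow> bool"
  where "class_C1 f \<longleftrightarrow> (\<forall>x. f differentiable (at x)) \<and> continuous_on UNIV (fderiv f)"

section \<open>Schauder bases indexed by a set of natural numbers\<close>

text \<open>
  A family of scalars indexed by \<open>J\<close>, a finite or infinite set of natural numbers, is a function
  on the natural numbers that vanishes outside \<open>J\<close>. With this convention the series over \<open>J\<close>, taken in
  increasing order of the indices, is the ordinary series: its partial sums are the partial sums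
  over \<open>J\<close>, with repetitions. For finite \<open>J\<close> the series is the finite sum and a Schauder basis is
  a linear basis.
\<close>

definition families :: "nat set \<Rightarrow> (nat \<Rightarrow> real) set"
  where "families J = {a. \<forall>i. i \<notin> J \<longrightarrow> a i = 0}"

text \<open>The Banach space spanned is a closed subspace \<open>X\<close> of the ambient Banach space.\<close>

definition schauder_basis :: "nat set \<Rightarrow> (nat \<Rightarrow> 'v::banach) \<Rightarrow> 'v set \<Rightarrow> bool"
  where "schauder_basis J v X \<longleftrightarrow>
    subspace X \<and> closed X \<and> (\<forall>i\<in>J. v i \<in> X) \<and>
    (\<forall>x\<in>X. \<exists>!a. a \<in> families J \<and> (\<lambda>i. a i *\<^sub>R v i) sums x)"

text \<open>
  Functionals on \<open>X\<close> are represented by functions that vanish outside \<open>X\<close>.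
\<close>

definition biorthogonal ::
    "nat set \<Rightarrow> (nat \<Rightarrow> 'v::banach) \<Rightarrow> 'v set \<Rightarrow> nat \<Rightarrow> 'v \<Rightarrow> real"
  where "biorthogonal J v X i x =
    (if x \<in> X then (THE a. a \<in> families J \<and> (\<lambda>j. a j *\<^sub>R v j) sums x) i else 0)"

definition linear_on_subspace ::
    "'v::real_vector set \<Rightarrow> ('v \<Rightarrow> 'w::real_vector) \<Rightarrow> bool"
  where "linear_on_subspace X f \<longleftrightarrow>
    (\<forall>x\<in>X. \<forall>y\<in>X. f (x + y) = f x + f y) \<and> (\<forall>c. \<forall>x\<in>X. f (c *\<^sub>R x) = c *\<^sub>R f x)"

definition dual_of :: "'v::real_normed_vector set \<Rightarrow> ('v \<Rightarrow> real) set"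
  where "dual_of X = {\<phi>. (\<forall>x. x \<notin> X \<longrightarrow> \<phi> x = 0) \<and> linear_on_subspace X \<phi> \<and>
    (\<exists>C. \<forall>x\<in>X. \<bar>\<phi> x\<bar> \<le> C * norm x)}"

definition dual_norm :: "'v::real_normed_vector set \<Rightarrow> ('v \<Rightarrow> real) \<Rightarrow> real"
  where "dual_norm X \<phi> = (SUP x\<in>{x\<in>X. norm x \<le> 1}. \<bar>\<phi> x\<bar>)"

definition besselian :: "nat set \<Rightarrow> (nat \<Rightarrow> 'v::banach) \<Rightarrow> 'v set \<Rightarrow> bool"
  where "besselian J v X \<longleftrightarrow> schauder_basis J v X \<and>
    (\<forall>a\<in>families J. summable (\<lambda>i. a i *\<^sub>R v i) \<longrightarrow> summable (\<lambda>i. (a i)\<^sup>2))"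

definition hilbertian :: "nat set \<Rightarrow> (nat \<Rightarrow> 'v::banach) \<Rightarrow> 'v set \<Rightarrow> bool"
  where "hilbertian J v X \<longleftrightarrow> schauder_basis J v X \<and>
    (\<forall>a\<in>families J. summable (\<lambda>i. (a i)\<^sup>2) \<longrightarrow> summable (\<lambda>i. a i *\<^sub>R v i))"

definition boundedly_complete :: "nat set \<Rightarrow> (nat \<Rightarrow> 'v::banach) \<Rightarrow> 'v set \<Rightarrow> bool"
  where "boundedly_complete J v X \<longleftrightarrow> schauder_basis J v X \<and>
    (\<forall>a\<in>families J. bdd_above (range (\<lambda>N. norm (\<Sum>i<N. a i *\<^sub>R v i)))
      \<longrightarrow> summable (\<lambda>i. a i *\<^sub>R v i))"

text \<open>
  The second and third conjuncts say that the biorthogonal functionals are a Schauder basis of the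
  dual of \<open>X\<close>; since that dual is not a type, convergence in it is spelled out via its norm.
\<close>

definition shrinking :: "nat set \<Rightarrow> (nat \<Rightarrow> 'v::banach) \<Rightarrow> 'v set \<Rightarrow> bool"
  where "shrinking J v X \<longleftrightarrow> schauder_basis J v X \<and>
    (\<forall>i\<in>J. biorthogonal J v X i \<in> dual_of X) \<and>
    (\<forall>\<phi>\<in>dual_of X. \<exists>!a. a \<in> families J \<and>
      (\<lambda>N. dual_norm X (\<lambda>x. \<phi> x - (\<Sum>i<N. a i * biorthogonal J v X i x))) \<longlonglongrightarrow> 0)"

section \<open>The sequence space \<open>Y(J)\<close>\<close>

definition Y_space :: "(nat \<Rightarrow> 'f::banach) \<Rightarrow> nat set \<Rightarrow> (nat \<Rightarrow> real) set"
  where "Y_space b J = {c \<in> families J. summable (\<lambda>i. c i *\<^sub>R b i)}"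

definition Y_norm :: "(nat \<Rightarrow> 'f::banach) \<Rightarrow> (nat \<Rightarrow> real) \<Rightarrow> real"
  where "Y_norm b c = (SUP N. norm (\<Sum>i<N. c i *\<^sub>R b i))"

text \<open>
  The value 0 outside the space only serves to satisfy the axioms of \<^locale>\<open>Metric_space\<close>,
  which demand nonnegativity and symmetry on the whole type.
\<close>

definition Y_dist ::
    "(nat \<Rightarrow> 'f::banach) \<Rightarrow> nat set \<Rightarrow> (nat \<Rightarrow> real) \<Rightarrow> (nat \<Rightarrow> real) \<Rightarrow> real"
  where "Y_dist b J c d =
    (if c \<in> Y_space b J \<and> d \<in> Y_space b J then Y_norm b (\<lambda>i. c i - d i) else 0)"

section \<open>The Constant Rank Condition Plus\<close>

definition topological_isomorphism ::
    "'v::real_normed_vector set \<Rightarrow> 'w::real_normed_vector set \<Rightarrow> ('v \<Rightarrow> 'w) \<Rightarrow> bool"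
  where "topological_isomorphism X Y z \<longleftrightarrow>
    linear_on_subspace X z \<and> (\<exists>z'. homeomorphism X Y z z')"

definition CRC_plus ::
    "(nat \<Rightarrow> 'f::banach) \<Rightarrow> nat set \<Rightarrow> (nat \<Rightarrow> 'e::banach \<Rightarrow> real) \<Rightarrow> 'e \<Rightarrow> 'e set \<Rightarrow> bool"
  where "CRC_plus b I0 g x0 V \<longleftrightarrow>
    x0 \<in> interior V \<and>
    (\<exists>J2. J2 \<subseteq> I0 \<and>
      (let X = (\<lambda>J x. closure (span ((\<lambda>i. fderiv (g i) x) ` J)));
           X1 = X I0 x0;
           v0 = (\<lambda>i. fderiv (g i) x0)
       in
        (\<forall>x\<in>V. schauder_basis J2 (\<lambda>i. fderiv (g i) x) (X I0 x)) \<and>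
        (\<forall>x\<in>V. \<exists>z. topological_isomorphism (X J2 x) (X J2 x0) z \<and>
          (\<forall>i\<in>J2. z (fderiv (g i) x) = v0 i)) \<and>
        closedin (Metric_space.mtopology (Y_space b J2) (Y_dist b J2))
          (range (\<lambda>e i. if i \<in> J2 then blinfun_apply (v0 i) e else 0)) \<and>
        shrinking J2 v0 X1 \<and> boundedly_complete J2 v0 X1 \<and>
        besselian J2 v0 X1 \<and>
        (\<forall>i\<in>J2. \<exists>e. \<forall>\<phi>\<in>X1. biorthogonal J2 v0 X1 i \<phi> = blinfun_apply \<phi> e)))"

section \<open>Constrained minimization and Lagrange multipliers\<close>

definition feasible_set :: "'i set \<Rightarrow> ('i \<Rightarrow> 'e \<Rightarrow> real) \<Rightarrow> 'e set"
  where "feasible_set I0 g = {x. \<forall>i\<in>I0. g i x = 0}"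

definition local_minimizer :: "('e::topological_space \<Rightarrow> real) \<Rightarrow> 'e set \<Rightarrow> 'e \<Rightarrow> bool"
  where "local_minimizer f S x0 \<longleftrightarrow>
    x0 \<in> S \<and> (\<exists>U. open U \<and> x0 \<in> U \<and> (\<forall>x\<in>U \<inter> S. f x0 \<le> f x))"

definition adjoint_op ::
    "('e::real_normed_vector \<Rightarrow>\<^sub>L 'f::real_inner) \<Rightarrow> 'f \<Rightarrow> 'e \<Rightarrow>\<^sub>L real"
  where "adjoint_op A \<mu> = blinfun_inner_right \<mu> o\<^sub>L A"

definition lagrangian ::
    "('e \<Rightarrow> real) \<Rightarrow> ('e \<Rightarrow> 'f::real_inner) \<Rightarrow> 'e \<Rightarrow> 'f \<Rightarrow> real"
  where "lagrangian f0 G x \<mu> = f0 x + inner \<mu> (G x)"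

text \<open>For \<open>K = {0}\<close> and \<open>y = 0\<close> this is the whole space.\<close>

definition normal_cone :: "'f::real_inner set \<Rightarrow> 'f \<Rightarrow> 'f set"
  where "normal_cone K y = {\<mu>. y \<in> K \<and> (\<forall>k\<in>K. inner \<mu> (k - y) \<le> 0)}"

definition lagrange_multipliers ::
    "('e::real_normed_vector \<Rightarrow> real) \<Rightarrow> ('e \<Rightarrow> 'f::real_inner) \<Rightarrow> 'f set \<Rightarrow> 'e \<Rightarrow> 'f set"
  where "lagrange_multipliers f0 G K x0 =
    {\<mu> \<in> normal_cone K (G x0). fderiv (\<lambda>x. lagrangian f0 G x \<mu>) x0 = 0}"

end

theory Submission
  imports Defs
begin

text \<open>
  Because the basis \<open>b\<close> is Besselian and Hilbertian,
  deleting the coordinates outside a set \<open>J\<close> is a bounded projection \<open>P\<close> of the Hilbert space. With the set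
  \<open>J\<close> of the constant rank condition, \<open>p = P \<circ> G\<close> is the system of the constraints with index in \<open>J\<close>.
  Its derivative at \<open>x0\<close> has all of the range of \<open>P\<close> as its range: the biorthogonal functionals are
  evaluations, so every finite family of coordinates is attained, and the range is closed in \<open>Y(J)\<close>
  (\<open>constraint_coordinates_surjective\<close>).

  By the open mapping theorem and the theorem of Graves, \<open>p\<close> is metrically regular at \<open>x0\<close>: a point \<open>z\<close>
  near \<open>x0\<close> can be moved onto the zero set of \<open>p\<close> at a cost proportional to \<open>norm (p z)\<close>
  (\<open>metric_regularity\<close>).

  The remaining constraints hold automatically on this zero set near \<open>x0\<close>. Indeed, at each point near
  \<open>x0\<close> the derivative of every \<open>g i\<close> lies in the closed span of the derivatives with index in \<open>J\<close>, so
  \<open>g i\<close> is stationary along the zero set. That it is constant there does not follow from the usual rank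
  theorem, as the kernel of the derivative of \<open>p\<close> need not be complemented; instead, Ekeland's variational
  principle joins two nearby points of the zero set by a chain of small steps inside it
  (\<open>constant_on_fibre\<close>).

  Hence \<open>x0\<close> minimizes \<open>f0\<close> locally on the zero set of \<open>p\<close>. Metric regularity makes a multiple of
  \<open>norm \<circ> p\<close> an exact penalty, so the derivative of \<open>f0\<close> at \<open>x0\<close> is dominated by that of \<open>p\<close>
  (\<open>minimizer_derivative_dominated\<close>). It therefore factors through the derivative of \<open>G\<close> by a bounded
  functional on the Hilbert space, which the Riesz representation theorem turns into a vector; its
  negative is the multiplier.
\<close>

section \<open>Consequences of Baire's theorem\<close>

text \<open>
  Zabreiko's lemma. Some sublevel set of \<open>s\<close> is dense in a ball by Baire's theorem, and countable
  subadditivity lets points of the ball be reached by series of points of sublevel sets. Closed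
  graph and open mapping arguments are instances of it, for suitable seminorms.
\<close>

lemma countably_subadditive_seminorm_bounded:
  fixes s :: "'a::banach \<Rightarrow> real"
  assumes scale: "\<And>c x. s (c *\<^sub>R x) = \<bar>c\<bar> * s x"
    and countably_subadditive:
      "\<And>u x. u sums x \<Longrightarrow> summable (\<lambda>n. s (u n)) \<Longrightarrow> s x \<le> (\<Sum>n. s (u n))"
  shows "\<exists>K>0. \<forall>x. s x \<le> K * norm x"
proof -
  have s0: "s 0 = 0"
    using scale[of 0 0] by simp
  have triangle: "s (x + y) \<le> s x + s y" for x y
  proof -
    define u where "u n = (if n = 0 then x else if n = 1 then y else 0)" for n :: nat
    have "u sums (\<Sum>n\<in>{0,1}. u n)"
      by (rule sums_finite) (auto simp: u_def)
    then have *: "u sums (x + y)"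
      by (simp add: u_def)
    have "(\<lambda>n. s (u n)) sums (\<Sum>n\<in>{0,1}. s (u n))"
      by (rule sums_finite) (auto simp: u_def s0)
    then have "(\<lambda>n. s (u n)) sums (s x + s y)"
      by (simp add: u_def)
    with countably_subadditive[OF *] show ?thesis
      by (simp add: sums_iff)
  qed
  have minus: "s (- x) = s x" for x
    using scale[of "-1" x] by simp
  have nonneg: "0 \<le> s x" for x
    using triangle[of x "-x"] by (simp add: s0 minus)
  define A where "A n = closure {x. s x \<le> real n}" for n
  have "\<exists>n. interior (A n) \<noteq> {}"
  proof (rule ccontr)
    assume *: "\<nexists>n. interior (A n) \<noteq> {}"
    have "Met_TC.mtopology interior_of \<Union>(range A) = ({}::'a set)"
    proof (rule Met_TC.metric_Baire_category_alt)
      show "Met_TC.mcomplete TYPE('a)"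
        by (simp add: complete_UNIV)
    qed (use * in \<open>auto simp: A_def\<close>)
    moreover have "\<Union>(range A) = UNIV"
    proof -
      have "x \<in> A (nat \<lceil>s x\<rceil>)" for x
        unfolding A_def by (rule subsetD[OF closure_subset]) (simp add: of_nat_ceiling)
      then show ?thesis by blast
    qed
    ultimately show False
      by simp
  qed
  then obtain n a r where r: "r > 0" and ball: "ball a r \<subseteq> A n"
    by (meson ex_in_conv interior_subset mem_interior subset_trans)
  \<comment> \<open>Each set \<open>A n\<close> is convex and symmetric, so a ball around \<open>a\<close> inside it can be moved to the origin.\<close>
  have zero_ball: "\<exists>y. s y \<le> real n \<and> norm (x - y) < d" if "norm x < r" "d > 0" for x d
  proof -
    have "a + x \<in> A n" "a - x \<in> A n"
      using that by (auto intro!: subsetD[OF ball] simp: dist_norm)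
    then obtain y z where y: "s y \<le> n" "dist y (a + x) < d" and z: "s z \<le> n" "dist z (a - x) < d"
      unfolding A_def closure_approachable using \<open>d > 0\<close> by blast
    have "s ((1/2) *\<^sub>R (y - z)) \<le> (1/2) * (s y + s z)"
      using triangle[of y "-z"] scale[of "1/2" "y - z"] by (simp add: minus)
    moreover have "x - (1/2) *\<^sub>R (y - z) = (1/2) *\<^sub>R (((a + x) - y) - ((a - x) - z))"
      by (simp add: algebra_simps flip: scaleR_add_left)
    then have "norm (x - (1/2) *\<^sub>R (y - z)) \<le> (1/2) * (norm ((a + x) - y) + norm ((a - x) - z))"
      by (metis abs_of_pos half_gt_zero_iff norm_scaleR norm_triangle_ineq4 mult_left_mono zero_le_divide_1_iff zero_le_numeral zero_less_one)
    ultimately show ?thesis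
      using y z by (intro exI[of _ "(1/2) *\<^sub>R (y - z)"]) (auto simp: dist_norm norm_minus_commute)
  qed
  have scaled: "\<exists>y. s y \<le> c * real n \<and> norm (x - y) < (c / 2) * r"
    if "norm x < c * r" "c > 0" for x c
  proof -
    have "norm ((1 / c) *\<^sub>R x) < r" "r / 2 > 0"
      using that r by (auto simp: field_simps)
    then obtain y where y: "s y \<le> real n" "norm ((1 / c) *\<^sub>R x - y) < r / 2"
      using zero_ball by blast
    have "x - c *\<^sub>R y = c *\<^sub>R ((1 / c) *\<^sub>R x - y)"
      using that by (simp add: algebra_simps)
    then have "norm (x - c *\<^sub>R y) = c * norm ((1 / c) *\<^sub>R x - y)"
      using that by simp
    also have "\<dots> < c * (r / 2)"
      using y that by (intro mult_strict_left_mono) auto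
    finally show ?thesis
      using y that by (intro exI[of _ "c *\<^sub>R y"]) (auto simp: scale)
  qed
  have "\<forall>k x. \<exists>y. norm x < (1/2)^k * r \<longrightarrow> s y \<le> (1/2)^k * real n \<and> norm (x - y) < (1/2)^Suc k * r"
    using scaled[of _ "(1/2)^_"] by simp
  then obtain f where f: "norm x < (1/2)^k * r \<Longrightarrow>
      s (f k x) \<le> (1/2)^k * real n \<and> norm (x - f k x) < (1/2)^Suc k * r" for k x
    by metis
  \<comment> \<open>Subtracting approximants halves the remainder each time, so \<open>x\<close> is the sum of a series
    whose seminorms are dominated by a geometric series: the closure is removed at the cost of a factor 2.\<close>
  have bound: "s x \<le> 2 * real n" if x: "norm x < r" for x
  proof -
    define w where "w = rec_nat x (\<lambda>k v. v - f k v)"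
    have w0: "w 0 = x" and wS: "w (Suc k) = w k - f k (w k)" for k
      by (simp_all add: w_def)
    have w: "norm (w k) < (1/2)^k * r" for k
      using x f by (induction k) (auto simp: w0 wS)
    have partial: "(\<Sum>k<m. f k (w k)) = x - w m" for m
      by (induction m) (auto simp: w0 wS)
    have "w \<longlonglongrightarrow> 0"
    proof (rule Lim_null_comparison)
      show "\<forall>\<^sub>F k in sequentially. norm (w k) \<le> (1/2)^k * r"
        using w by (auto intro!: always_eventually less_imp_le)
      show "(\<lambda>k. (1/2)^k * r) \<longlonglongrightarrow> 0"
        by (intro tendsto_mult_left_zero LIMSEQ_realpow_zero) auto
    qed
    then have "(\<lambda>m. x - w m) \<longlonglongrightarrow> x - 0"
      by (intro tendsto_intros)
    then have sums: "(\<lambda>k. f k (w k)) sums x"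
      by (simp add: sums_def partial)
    have geo: "(\<lambda>k. (1/2)^k * real n) sums (2 * real n)"
      using sums_mult2[OF geometric_sums[of "1/2::real"], of "real n"] by simp
    have le: "s (f k (w k)) \<le> (1/2)^k * real n" for k
      using f w by blast
    have "summable (\<lambda>k. s (f k (w k)))"
      by (rule summable_comparison_test'[OF sums_summable[OF geo], of 0])
        (use le nonneg in \<open>simp add: abs_of_nonneg\<close>)
    then show ?thesis
      using countably_subadditive[OF sums] suminf_le[OF le _ sums_summable[OF geo]] sums_unique[OF geo]
      by simp
  qed
  \<comment> \<open>The summand 1 only makes the constant positive.\<close>
  have "s x \<le> ((4 * real n + 1) / r) * norm x" for x
  proof (cases "x = 0")
    case False
    define c where "c = r / (2 * norm x)"
    have c: "c > 0"
      using False r by (simp add: c_def)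
    have "norm (c *\<^sub>R x) < r"
      using False r by (simp add: c_def)
    then have "c * s x \<le> 2 * real n"
      using bound[of "c *\<^sub>R x"] c by (simp add: scale)
    also have "\<dots> \<le> c * (((4 * real n + 1) / r) * norm x)"
      using False r by (simp add: c_def)
    finally show ?thesis
      by (rule mult_left_le_imp_le[OF _ c])
  qed (simp add: s0)
  moreover have "(4 * real n + 1) / r > 0"
    using r by simp
  ultimately show ?thesis
    by blast
qed

text \<open>
  The open mapping theorem, in the form that solutions of \<open>T h = P y\<close> can be chosen with norm
  controlled by \<open>y\<close>: the least norm of a solution is a countably subadditive seminorm of \<open>y\<close>, because
  solutions for the terms of a series add up to a solution for its sum.
\<close>

lemma bounded_lifting:
  fixes T :: "'a::banach \<Rightarrow> 'b::real_normed_vector" and P :: "'c::banach \<Rightarrow> 'b"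
  assumes T: "bounded_linear T" and P: "bounded_linear P" and range: "range P \<subseteq> range T"
  shows "\<exists>K>0. \<forall>y. \<exists>h. T h = P y \<and> norm h \<le> K * norm y"
proof -
  interpret T: bounded_linear T by (rule T)
  interpret P: bounded_linear P by (rule P)
  define N where "N y = norm ` {h. T h = P y}" for y
  define s where "s y = Inf (N y)" for y
  have ex: "\<exists>h. T h = P y" for y
    using range by (metis imageE range_subsetD)
  have lower: "s y \<le> norm h" if "T h = P y" for y h
    unfolding s_def N_def using that by (intro cInf_lower bdd_belowI[of _ 0]) auto
  have approx: "\<exists>h. T h = P y \<and> norm h < s y + e" if "e > 0" for y e
  proof -
    have "\<exists>t\<in>N y. t < s y + e"
      unfolding s_def using ex that
      by (subst cInf_less_iff[symmetric]) (auto simp: N_def intro!: bdd_belowI[of _ 0])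
    then show ?thesis
      by (auto simp: N_def)
  qed
  have nonneg: "0 \<le> s y" for y
    unfolding s_def using ex by (intro cInf_greatest) (auto simp: N_def)
  have "\<exists>K>0. \<forall>y. s y \<le> K * norm y"
  proof (rule countably_subadditive_seminorm_bounded)
    \<comment> \<open>Homogeneity follows from this inequality for \<open>c\<close> and for \<open>1 / c\<close>.\<close>
    have le: "s (c *\<^sub>R y) \<le> \<bar>c\<bar> * s y" if "c \<noteq> 0" for c y
    proof (rule field_le_epsilon)
      fix e :: real assume "e > 0"
      then have "0 < e / \<bar>c\<bar>"
        using that by simp
      then obtain h where h: "T h = P y" "norm h < s y + e / \<bar>c\<bar>"
        using approx by blast
      have "s (c *\<^sub>R y) \<le> norm (c *\<^sub>R h)"
        by (rule lower) (simp add: T.scaleR P.scaleR h)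
      also have "\<dots> \<le> \<bar>c\<bar> * (s y + e / \<bar>c\<bar>)"
        using h(2) by (simp add: mult_left_mono)
      finally show "s (c *\<^sub>R y) \<le> \<bar>c\<bar> * s y + e"
        using that by (simp add: distrib_left)
    qed
    show "s (c *\<^sub>R y) = \<bar>c\<bar> * s y" for c y
    proof (cases "c = 0")
      case True
      then show ?thesis
        using lower[of 0 0] nonneg[of 0] by (simp add: T.zero P.zero)
    next
      case False
      then show ?thesis
        using le[of c y] le[of "1 / c" "c *\<^sub>R y"] by (simp add: field_simps)
    qed
    fix u y assume u: "u sums y" and su: "summable (\<lambda>n. s (u n))"
    show "s y \<le> (\<Sum>n. s (u n))"
    proof (rule field_le_epsilon)
      fix e :: real assume "e > 0"
      have "\<forall>n. \<exists>h. T h = P (u n) \<and> norm h < s (u n) + e * (1/2)^Suc n"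
        using approx \<open>e > 0\<close> by simp
      then obtain h where h: "\<And>n. T (h n) = P (u n)" "\<And>n. norm (h n) < s (u n) + e * (1/2)^Suc n"
        by metis
      have geo: "(\<lambda>n. s (u n) + e * (1/2)^Suc n) sums ((\<Sum>n. s (u n)) + e)"
        using sums_add[OF summable_sums[OF su] sums_mult[OF power_half_series, of e]] by simp
      have sh: "summable (\<lambda>n. norm (h n))"
        by (rule summable_comparison_test'[OF sums_summable[OF geo], of 0])
          (use h(2) in \<open>simp add: less_imp_le\<close>)
      have "T (\<Sum>n. h n) = (\<Sum>n. T (h n))"
        using summable_norm_cancel[OF sh] by (rule T.suminf)
      also have "\<dots> = P y"
        using sums_unique[OF P.sums[OF u]] by (simp add: h(1))
      finally have "s y \<le> norm (\<Sum>n. h n)"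
        by (rule lower)
      also have "\<dots> \<le> (\<Sum>n. norm (h n))"
        by (rule summable_norm[OF sh])
      also have "\<dots> \<le> (\<Sum>n. s (u n)) + e"
        using suminf_le[OF less_imp_le[OF h(2)] sh sums_summable[OF geo]] sums_unique[OF geo] by simp
      finally show "s y \<le> (\<Sum>n. s (u n)) + e" .
    qed
  qed
  then obtain K where K: "K > 0" "\<And>y. s y \<le> K * norm y"
    by blast
  have "\<exists>h. T h = P y \<and> norm h \<le> (K + 1) * norm y" for y
  proof (cases "y = 0")
    case True
    then show ?thesis
      by (intro exI[of _ 0]) (simp add: T.zero P.zero)
  next
    case False
    then obtain h where "T h = P y" "norm h < s y + norm y"
      using approx[of "norm y" y] by auto
    then show ?thesis
      using K(2)[of y] by (intro exI[of _ h]) (simp add: distrib_right)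
  qed
  then show ?thesis
    using K(1) by (intro exI[of _ "K + 1"]) simp
qed

section \<open>Functionals on Hilbert space\<close>

text \<open>
  The Riesz representation theorem; \<open>\<mu>\<close> is the minimizer of \<open>inner y y - 2 * l y\<close>.
\<close>

lemma riesz_representation:
  fixes l :: "'a::{real_inner, banach} \<Rightarrow> real"
  assumes l: "bounded_linear l"
  obtains \<mu> where "\<And>y. l y = inner \<mu> y"
proof -
  interpret l: bounded_linear l by (rule l)
  define J where "J y = inner y y - 2 * l y" for y
  obtain K where K: "\<And>y. \<bar>l y\<bar> \<le> norm y * K"
    using l.bounded by auto
  have J_lower: "- K\<^sup>2 \<le> J y" for y
  proof -
    have "0 \<le> (norm y - K)\<^sup>2" by simp
    then show ?thesis
      using K[of y] by (simp add: J_def power2_eq_square dot_square_norm algebra_simps)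
  qed
  have bdd: "bdd_below (range J)"
    using J_lower by (auto intro!: bdd_belowI)
  define m where "m = Inf (range J)"
  have m: "m \<le> J y" for y
    unfolding m_def by (rule cInf_lower) (auto simp: bdd)
  have "\<exists>y. J y < m + (1/2)^k" for k
  proof -
    have "\<exists>t\<in>range J. t < m + (1/2)^k"
      unfolding m_def by (subst cInf_less_iff[symmetric]) (auto simp: bdd)
    then show ?thesis by blast
  qed
  then obtain u where u: "\<And>k. J (u k) < m + (1/2)^k"
    by metis
  \<comment> \<open>Parallelogram identity: minimizing sequences of \<open>J\<close> are Cauchy sequences.\<close>
  have para: "inner (y - z) (y - z) = 2 * J y + 2 * J z - 4 * J ((1/2) *\<^sub>R (y + z))" for y z
    by (simp add: J_def l.scaleR l.add algebra_simps inner_commute)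
  have close: "(dist (u i) (u j))\<^sup>2 \<le> 4 * (1/2)^k" if "k \<le> i" "k \<le> j" for i j k
  proof -
    have "(1/2::real)^i \<le> (1/2)^k" "(1/2::real)^j \<le> (1/2)^k"
      using that by (auto intro: power_decreasing)
    then show ?thesis
      using para[of "u i" "u j"] u[of i] u[of j] m[of "(1/2) *\<^sub>R (u i + u j)"]
      unfolding dist_norm dot_square_norm by linarith
  qed
  have "Cauchy u"
  proof (rule metric_CauchyI)
    fix e :: real assume "e > 0"
    obtain k where "(1/2::real)^k < e\<^sup>2 / 4"
      using real_arch_pow_inv[of "e\<^sup>2 / 4" "1/2"] \<open>e > 0\<close> by auto
    then have "4 * (1/2::real)^k < e\<^sup>2"
      by simp
    then have "dist (u i) (u j) < e" if "k \<le> i" "k \<le> j" for i j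
      using close[OF that] \<open>e > 0\<close> by (intro power_less_imp_less_base[of _ 2 e]) auto
    then show "\<exists>M. \<forall>m\<ge>M. \<forall>n\<ge>M. dist (u m) (u n) < e"
      by blast
  qed
  then obtain \<mu> where \<mu>: "u \<longlonglongrightarrow> \<mu>"
    using Cauchy_convergent convergent_def by blast
  have "(\<lambda>k. J (u k)) \<longlonglongrightarrow> J \<mu>"
    unfolding J_def by (intro tendsto_intros l.tendsto \<mu>)
  moreover have "(\<lambda>k. m + (1/2)^k) \<longlonglongrightarrow> m + 0"
    by (intro tendsto_intros LIMSEQ_realpow_zero) auto
  ultimately have J\<mu>: "J \<mu> \<le> m"
    using LIMSEQ_le[of "\<lambda>k. J (u k)" "J \<mu>" "\<lambda>k. m + (1/2)^k" "m + 0"] u by (auto intro: less_imp_le)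
  have "l y = inner \<mu> y" for y
  proof -
    define c where "c = inner \<mu> y - l y"
    have J_line: "J (\<mu> - t *\<^sub>R y) = J \<mu> - 2 * t * c + t\<^sup>2 * inner y y" for t
      by (simp add: J_def c_def l.diff l.scaleR algebra_simps inner_commute power2_eq_square)
    have "2 * t * c \<le> t\<^sup>2 * inner y y" for t
      using J\<mu> m[of "\<mu> - t *\<^sub>R y"] by (simp add: J_line)
    note step = this
    \<comment> \<open>A step along \<open>y\<close> that is short enough for the linear term to win, whatever \<open>inner y y\<close> is.\<close>
    define t where "t = c / (inner y y + 1)"
    have "inner y y + 1 > 0"
      by (simp add: add_nonneg_pos)
    then have c: "c = t * (inner y y + 1)"
      by (simp add: t_def)
    have "t\<^sup>2 * (inner y y + 2) \<le> 0"
      using step[of t] by (simp add: c power2_eq_square algebra_simps)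
    moreover have "inner y y + 2 > 0"
      by (simp add: add_nonneg_pos)
    ultimately have "t = 0"
      by (simp add: mult_le_0_iff)
    then show ?thesis
      using c by (simp add: c_def)
  qed
  with that show thesis
    by blast
qed

text \<open>
  The domination makes \<open>f\<close> a function of \<open>P (A h)\<close>. Since every value of \<open>P\<close> is of this form, \<open>f\<close>
  extends along \<open>A\<close> to a bounded functional on the whole Hilbert space.
\<close>

lemma dominated_functional_representation:
  fixes A :: "'a::real_normed_vector \<Rightarrow> 'f::{real_inner, banach}" and P :: "'f \<Rightarrow> 'g::real_normed_vector"
  assumes A: "linear A" and P: "bounded_linear P" and f: "linear f"
    and onto: "range P \<subseteq> range (P \<circ> A)"
    and dominated: "\<And>h. \<bar>f h\<bar> \<le> M * norm (P (A h))"
  obtains \<mu> where "\<And>h. f h = inner \<mu> (A h)"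
proof -
  interpret A: linear A by (rule A)
  interpret P: bounded_linear P by (rule P)
  interpret f: linear f by (rule f)
  have "\<forall>y. \<exists>h. P (A h) = P y"
    using onto by (metis comp_apply imageE range_subsetD)
  then obtain R where R: "\<And>y. P (A (R y)) = P y"
    by metis
  have eq: "f h = f k" if "P (A h) = P (A k)" for h k
    using dominated[of "h - k"] that by (simp add: f.diff A.diff P.diff)
  obtain C where C: "\<And>y. norm (P y) \<le> norm y * C"
    using P.bounded by blast
  have "bounded_linear (\<lambda>y. f (R y))"
  proof (rule bounded_linear_intro)
    fix y z :: 'f and t :: real
    show "f (R (y + z)) = f (R y) + f (R z)"
      using eq[of "R (y + z)" "R y + R z"] by (simp add: R P.add A.add f.add)
    show "f (R (t *\<^sub>R y)) = t *\<^sub>R f (R y)"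
      using eq[of "R (t *\<^sub>R y)" "t *\<^sub>R R y"] by (simp add: R P.scaleR A.scale f.scale)
    have "\<bar>f (R y)\<bar> \<le> M * norm (P y)"
      using dominated[of "R y"] by (simp add: R)
    also have "\<dots> \<le> \<bar>M\<bar> * (norm y * C)"
      using C[of y] by (intro mult_mono) auto
    finally show "norm (f (R y)) \<le> norm y * (\<bar>M\<bar> * C)"
      by (simp add: mult_ac)
  qed
  then obtain \<mu> where "\<And>y. f (R y) = inner \<mu> y"
    by (rule riesz_representation) blast
  moreover have "f h = f (R (A h))" for h
    by (rule eq) (simp add: R)
  ultimately show thesis
    using that by metis
qed

section \<open>Nonlinear equations and Ekeland's variational principle\<close>

text \<open>
  Ekeland's variational principle. It replaces a step-by-step descent that may need transfinitely
  many steps by a point from which no further step is possible.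
\<close>

lemma ekeland_variational_principle:
  fixes f :: "'a::complete_space \<Rightarrow> real"
  assumes "closed C" "continuous_on C f" "x \<in> C" "\<theta> > 0"
    and nonneg: "\<And>z. z \<in> C \<Longrightarrow> 0 \<le> f z"
  obtains z where "z \<in> C" "\<theta> * dist x z \<le> f x - f z"
    "\<And>w. w \<in> C \<Longrightarrow> \<theta> * dist z w \<le> f z - f w \<Longrightarrow> w = z"
proof -
  define S where "S z = {w\<in>C. \<theta> * dist z w \<le> f z - f w}" for z
  have refl: "z \<in> S z" if "z \<in> C" for z
    using that by (simp add: S_def)
  have trans: "S w \<subseteq> S z" if "w \<in> S z" for z w
  proof
    fix v assume "v \<in> S w"
    moreover have "\<theta> * dist z v \<le> \<theta> * (dist z w + dist w v)"
      using \<open>\<theta> > 0\<close> by (intro mult_left_mono dist_triangle) auto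
    ultimately show "v \<in> S z"
      using that by (auto simp: S_def algebra_simps)
  qed
  have bdd: "bdd_below (f ` S z)" for z
    using nonneg by (auto simp: S_def intro!: bdd_belowI[of _ 0])
  have "\<exists>w. z \<in> C \<longrightarrow> w \<in> S z \<and> f w < Inf (f ` S z) + (1/2)^k" for k z
  proof (cases "z \<in> C")
    case True
    then have "\<exists>y\<in>f ` S z. y < Inf (f ` S z) + (1/2)^k"
      using refl by (subst cInf_less_iff[symmetric]) (auto simp: bdd)
    then show ?thesis
      by blast
  qed simp
  then have "\<exists>F. \<forall>k z. z \<in> C \<longrightarrow> F k z \<in> S z \<and> f (F k z) < Inf (f ` S z) + (1/2)^k"
    by (intro choice allI)
  then obtain next_pt where next_pt:
    "z \<in> C \<Longrightarrow> next_pt k z \<in> S z \<and> f (next_pt k z) < Inf (f ` S z) + (1/2)^k" for k z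
    by blast
  \<comment> \<open>From \<open>u k\<close>, move to a point of \<open>S (u k)\<close> that nearly minimizes \<open>f\<close> there; what remains
    reachable afterwards has diameter tending to 0.\<close>
  define u where "u = rec_nat x next_pt"
  have u0: "u 0 = x" and uS: "u (Suc k) = next_pt k (u k)" for k
    by (simp_all add: u_def)
  have uC: "u k \<in> C" for k
    using \<open>x \<in> C\<close> next_pt by (induction k) (auto simp: u0 uS S_def)
  have step: "u (Suc k) \<in> S (u k)" for k
    using next_pt[OF uC] by (simp add: uS)
  have chain: "u (k + m) \<in> S (u k)" for k m
    using refl[OF uC] step trans by (induction m) (auto, blast)
  have small: "dist (u (Suc k)) w \<le> (1/2)^k / \<theta>" if "w \<in> S (u (Suc k))" for k w
  proof -
    have "w \<in> S (u k)"
      using that trans step by blast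
    then have "Inf (f ` S (u k)) \<le> f w"
      using bdd by (intro cInf_lower) auto
    moreover have "f (u (Suc k)) < Inf (f ` S (u k)) + (1/2)^k"
      using next_pt[OF uC] by (simp add: uS)
    ultimately have "\<theta> * dist (u (Suc k)) w \<le> (1/2)^k"
      using that by (auto simp: S_def)
    then show ?thesis
      using \<open>\<theta> > 0\<close> by (simp add: field_simps)
  qed
  have null: "(\<lambda>k. (1/2)^k / \<theta>) \<longlonglongrightarrow> 0"
    by (intro tendsto_divide_zero LIMSEQ_realpow_zero) auto
  have "Cauchy u"
  proof (rule metric_CauchyI)
    fix e :: real assume "e > 0"
    then obtain K where K: "(1/2)^K / \<theta> < e / 2"
      using order_tendstoD(2)[OF null, of "e / 2"] by (auto simp: eventually_sequentially)
    have "dist (u (Suc K)) (u m) < e / 2" if "m \<ge> Suc K" for m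
      using le_less_trans[OF small[OF chain[of "Suc K" "m - Suc K"]] K] that by simp
    then have "\<forall>m\<ge>Suc K. \<forall>n\<ge>Suc K. dist (u m) (u n) < e"
      by (meson dist_triangle_half_r)
    then show "\<exists>M. \<forall>m\<ge>M. \<forall>n\<ge>M. dist (u m) (u n) < e"
      by blast
  qed
  then obtain z where z: "u \<longlonglongrightarrow> z"
    using Cauchy_convergent convergent_def by blast
  have "z \<in> C"
    using closed_sequentially[OF \<open>closed C\<close> _ z] uC by blast
  have fz: "(\<lambda>k. f (u k)) \<longlonglongrightarrow> f z"
    using continuous_on_tendsto_compose[OF \<open>continuous_on C f\<close> z \<open>z \<in> C\<close>] uC by simp
  have zS: "z \<in> S (u k)" for k
  proof -
    have "(\<lambda>m. \<theta> * dist (u k) (u m)) \<longlonglongrightarrow> \<theta> * dist (u k) z"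
      by (intro tendsto_intros z)
    moreover have "(\<lambda>m. f (u k) - f (u m)) \<longlonglongrightarrow> f (u k) - f z"
      by (intro tendsto_intros fz)
    moreover have "\<exists>N. \<forall>m\<ge>N. \<theta> * dist (u k) (u m) \<le> f (u k) - f (u m)"
      using chain[of k] by (intro exI[of _ k]) (auto simp: S_def dest!: le_Suc_ex)
    ultimately have "\<theta> * dist (u k) z \<le> f (u k) - f z"
      by (rule LIMSEQ_le)
    then show ?thesis
      using \<open>z \<in> C\<close> by (simp add: S_def)
  qed
  show thesis
  proof (rule that)
    show "z \<in> C" by fact
    show "\<theta> * dist x z \<le> f x - f z"
      using zS[of 0] by (simp add: u0 S_def)
    fix w assume "w \<in> C" "\<theta> * dist z w \<le> f z - f w"
    then have "w \<in> S (u k)" for k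
      using trans[OF zS] by (auto simp: S_def)
    then have "\<forall>k. dist (u (Suc k)) w \<le> (1/2)^k / \<theta>"
      using small by blast
    then have "(\<lambda>k. dist (u (Suc k)) w) \<longlonglongrightarrow> 0"
      using null by (intro tendsto_sandwich[OF _ _ tendsto_const null]) auto
    then have "(\<lambda>k. u (Suc k)) \<longlonglongrightarrow> w"
      using tendsto_dist_iff by blast
    with LIMSEQ_Suc[OF z] show "w = z"
      using LIMSEQ_unique by blast
  qed
qed

text \<open>
  Graves' theorem: the distance to the zero set is controlled by the residual. By Ekeland's principle
  for \<open>norm \<circ> p\<close>, there is a point \<open>u\<close> near \<open>z\<close> from which the residual cannot drop at slope
  \<open>1 / (2 * K)\<close>. If \<open>p u\<close> were nonzero, then a short step along \<open>- h\<close> with \<open>p' x0 h = p u\<close> would lower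
  the residual at a greater slope.
\<close>

lemma metric_regularity:
  fixes p :: "'a::banach \<Rightarrow> 'b::real_normed_vector" and p' :: "'a \<Rightarrow> 'a \<Rightarrow>\<^sub>L 'b"
  assumes der: "\<And>x. x \<in> ball x0 r \<Longrightarrow> (p has_derivative blinfun_apply (p' x)) (at x)"
    and close: "\<And>x. x \<in> ball x0 r \<Longrightarrow> norm (p' x - p' x0) \<le> \<epsilon>"
    and inv: "\<And>x. x \<in> ball x0 r \<Longrightarrow> \<exists>h. blinfun_apply (p' x0) h = p x \<and> norm h \<le> K * norm (p x)"
    and K: "K > 0" "\<epsilon> * K \<le> 1 / 4"
    and z: "dist x0 z + 2 * K * norm (p z) < r"
  shows "\<exists>z'. p z' = 0 \<and> dist z z' \<le> 2 * K * norm (p z)"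
proof -
  define R where "R = dist x0 z + 2 * K * norm (p z)"
  have R: "cball x0 R \<subseteq> ball x0 r"
    using z by (auto simp: R_def)
  have "continuous_on (cball x0 R) p"
    using has_derivative_continuous[OF der] R by (intro continuous_at_imp_continuous_on) blast
  then have "continuous_on (cball x0 R) (\<lambda>w. norm (p w))"
    by (intro continuous_intros)
  moreover have "z \<in> cball x0 R"
    using K by (simp add: R_def)
  ultimately obtain u where u: "u \<in> cball x0 R" "1 / (2 * K) * dist z u \<le> norm (p z) - norm (p u)"
    and stuck: "\<And>w. w \<in> cball x0 R \<Longrightarrow> 1 / (2 * K) * dist u w \<le> norm (p u) - norm (p w) \<Longrightarrow> w = u"
    using ekeland_variational_principle[of "cball x0 R" "\<lambda>w. norm (p w)" z "1 / (2 * K)"] K by auto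
  have dist_u: "dist z u \<le> 2 * K * (norm (p z) - norm (p u))"
    using u(2) K by (simp add: field_simps)
  have "p u = 0"
  proof (rule ccontr)
    assume nz: "p u \<noteq> 0"
    have u_ball: "u \<in> ball x0 r"
      using u(1) R by blast
    obtain h where h: "blinfun_apply (p' x0) h = p u" "norm h \<le> K * norm (p u)"
      using inv[OF u_ball] by blast
    have "h \<noteq> 0"
      using h(1) nz by auto
    obtain d where d: "d > 0"
      and lin: "\<And>y. norm (y - u) < d \<Longrightarrow> norm (p y - p u - blinfun_apply (p' u) (y - u)) \<le> 1 / (8 * K) * norm (y - u)"
      using der[OF u_ball] K unfolding has_derivative_at_alt
      by (metis divide_pos_pos mult_pos_pos zero_less_numeral zero_less_one)
    have "0 < 2 * K * norm (p u)"
      using K nz by simp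
    then have "dist x0 u < R"
      using dist_u dist_triangle[of x0 u z] by (simp add: R_def right_diff_distrib)
    \<comment> \<open>A step \<open>m\<close> so short that \<open>u - m *\<^sub>R h\<close> stays in the ball and within the
      distance \<open>d\<close> of \<open>u\<close>, where the linearization is accurate.\<close>
    define m where "m = min 1 (min (d / 2) (R - dist x0 u) / norm h)"
    have "m > 0"
      using \<open>h \<noteq> 0\<close> d \<open>dist x0 u < R\<close> by (simp add: m_def)
    have m: "m \<le> 1" "m * norm h \<le> d / 2" "m * norm h \<le> R - dist x0 u"
      using \<open>h \<noteq> 0\<close> by (auto simp: m_def min_def field_simps)
    define w where "w = u - m *\<^sub>R h"
    have dist_w: "dist u w = m * norm h" "norm (w - u) = m * norm h"
      using \<open>m > 0\<close> by (auto simp: w_def dist_norm)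
    have "w \<in> cball x0 R"
      using dist_triangle[of x0 w u] dist_w m by simp
    have "norm (p w - p u + m *\<^sub>R blinfun_apply (p' u) h) \<le> 1 / (8 * K) * (m * norm h)"
    proof -
      have "norm (w - u) < d"
        using dist_w m(2) d by linarith
      from lin[OF this] show ?thesis
        unfolding dist_w(2) by (simp add: w_def blinfun.bilinear_simps)
    qed
    also have "\<dots> \<le> 1 / (8 * K) * (m * (K * norm (p u)))"
      using h(2) K \<open>m > 0\<close> by (intro mult_left_mono) auto
    also have "\<dots> = m * norm (p u) / 8"
      using K by simp
    finally have A: "norm (p w - p u + m *\<^sub>R blinfun_apply (p' u) h) \<le> m * norm (p u) / 8" .
    have "norm (blinfun_apply (p' u - p' x0) h) \<le> \<epsilon> * (K * norm (p u))"
      using norm_blinfun[of "p' u - p' x0" h] close[OF u_ball] h(2)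
      by (smt (verit, best) mult_mono norm_ge_zero)
    also have "\<dots> \<le> 1 / 4 * norm (p u)"
      using K(2) by (metis mult.assoc mult_right_mono norm_ge_zero)
    finally have B: "norm (m *\<^sub>R blinfun_apply (p' u - p' x0) h) \<le> m * norm (p u) / 4"
      using \<open>m > 0\<close> by simp
    have "p w = (p w - p u + m *\<^sub>R blinfun_apply (p' u) h) - m *\<^sub>R blinfun_apply (p' u - p' x0) h
        + (1 - m) *\<^sub>R p u"
      by (simp add: blinfun.bilinear_simps h(1) algebra_simps)
    then have "norm (p w) \<le> norm (p w - p u + m *\<^sub>R blinfun_apply (p' u) h)
        + norm (m *\<^sub>R blinfun_apply (p' u - p' x0) h) + norm ((1 - m) *\<^sub>R p u)"
      by (metis norm_triangle_ineq norm_triangle_ineq4 add_right_mono order_trans)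
    also have "\<dots> \<le> m * norm (p u) / 8 + m * norm (p u) / 4 + (1 - m) * norm (p u)"
      using A B m by simp
    finally have decrease: "m * norm (p u) / 2 \<le> norm (p u) - norm (p w)"
      using mult_nonneg_nonneg[of m "norm (p u)"] norm_ge_zero[of "p u"] \<open>m > 0\<close>
      unfolding left_diff_distrib by linarith
    have "1 / (2 * K) * dist u w \<le> 1 / (2 * K) * (m * (K * norm (p u)))"
      using h(2) K \<open>m > 0\<close> unfolding dist_w by (intro mult_left_mono) auto
    also have "\<dots> = m * norm (p u) / 2"
      using K by simp
    finally have "w = u"
      using stuck[OF \<open>w \<in> cball x0 R\<close>] decrease by linarith
    then show False
      using dist_w \<open>m > 0\<close> \<open>h \<noteq> 0\<close> by simp
  qed
  then show ?thesis
    using dist_u by auto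
qed

text \<open>
  If both ends lie on one fibre of \<open>p\<close>, then \<open>p'\<close> is of second order on their difference, and
  the domination hands this on to \<open>q'\<close>.
\<close>

lemma stationary_along_fibre:
  fixes p :: "'a::real_normed_vector \<Rightarrow> 'b::real_normed_vector" and q :: "'a \<Rightarrow> real"
  assumes p: "(p has_derivative p') (at z)" and q: "(q has_derivative q') (at z)"
    and dominated: "\<And>\<eta>. \<eta> > 0 \<Longrightarrow> \<exists>M. \<forall>h. \<bar>q' h\<bar> \<le> M * norm (p' h) + \<eta> * norm h"
    and "\<eta> > 0"
  shows "\<exists>\<delta>>0. \<forall>w. p w = p z \<longrightarrow> dist z w < \<delta> \<longrightarrow> dist (q z) (q w) \<le> \<eta> * dist z w"
proof -
  obtain M where M: "\<And>h. \<bar>q' h\<bar> \<le> M * norm (p' h) + \<eta> / 3 * norm h"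
    using dominated[of "\<eta> / 3"] \<open>\<eta> > 0\<close> by auto
  define c where "c = \<eta> / (3 * (\<bar>M\<bar> + 1))"
  have "c > 0" "\<bar>M\<bar> * c \<le> \<eta> / 3"
    using \<open>\<eta> > 0\<close> by (auto simp: c_def field_simps)
  obtain d1 where d1: "d1 > 0"
    "\<And>w. norm (w - z) < d1 \<Longrightarrow> norm (p w - p z - p' (w - z)) \<le> c * norm (w - z)"
    using p \<open>c > 0\<close> unfolding has_derivative_at_alt by blast
  obtain d2 where d2: "d2 > 0"
    "\<And>w. norm (w - z) < d2 \<Longrightarrow> norm (q w - q z - q' (w - z)) \<le> \<eta> / 3 * norm (w - z)"
    using q \<open>\<eta> > 0\<close> unfolding has_derivative_at_alt
    by (metis divide_pos_pos zero_less_numeral)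
  have "dist (q z) (q w) \<le> \<eta> * dist z w" if "p w = p z" "dist z w < min d1 d2" for w
  proof -
    have n: "norm (w - z) = dist z w"
      by (simp add: dist_norm norm_minus_commute)
    have "norm (p' (w - z)) \<le> c * dist z w"
      using d1(2)[of w] that n by simp
    then have "M * norm (p' (w - z)) \<le> \<bar>M\<bar> * (c * dist z w)"
      by (intro mult_mono) auto
    also have "\<dots> = (\<bar>M\<bar> * c) * dist z w"
      by simp
    also have "\<dots> \<le> \<eta> / 3 * dist z w"
      using \<open>\<bar>M\<bar> * c \<le> \<eta> / 3\<close> by (intro mult_right_mono) auto
    finally have "\<bar>q' (w - z)\<bar> \<le> \<eta> / 3 * dist z w + \<eta> / 3 * dist z w"
      using M[of "w - z"] n by simp
    moreover have "\<bar>q w - q z - q' (w - z)\<bar> \<le> \<eta> / 3 * dist z w"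
      using d2(2)[of w] that n by simp
    ultimately show ?thesis
      unfolding dist_real_def by linarith
  qed
  then show ?thesis
    using d1(1) d2(1) by (intro exI[of _ "min d1 d2"]) auto
qed

text \<open>
  This takes the place of the constant rank theorem. The kernel of \<open>p' x0\<close> need not be complemented,
  so the fibre need not be a manifold and its points need not be joined by smooth curves along which
  \<open>q\<close> could be integrated. But from any point of the fibre, a small step straight towards \<open>y\<close> can be
  corrected onto the fibre at a cost of a quarter of the step, since the direction is almost tangent.
  Ekeland's principle continues these steps until \<open>y\<close> is reached, while \<open>q\<close> changes by at most
  \<open>\<eta>\<close> times the distance covered. Only pointwise differentiability is used along the way, so \<open>\<eta>\<close> is
  arbitrary.
\<close>

lemma constant_on_fibre:
  fixes p :: "'a::banach \<Rightarrow> 'b::real_normed_vector" and p' :: "'a \<Rightarrow> 'a \<Rightarrow>\<^sub>L 'b"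
    and q :: "'a \<Rightarrow> 'c::metric_space"
  assumes cont: "continuous_on UNIV p" "continuous_on UNIV q"
    and der: "\<And>x. x \<in> ball x0 r \<Longrightarrow> (p has_derivative blinfun_apply (p' x)) (at x)"
    and close: "\<And>x. x \<in> ball x0 r \<Longrightarrow> norm (p' x - p' x0) \<le> \<epsilon>"
    and regular: "\<And>z. z \<in> ball x0 r \<Longrightarrow> \<exists>z'. p z' = 0 \<and> dist z z' \<le> \<kappa> * norm (p z)"
    and \<kappa>: "\<kappa> > 0" "\<epsilon> > 0" "\<kappa> * \<epsilon> \<le> 1 / 12"
    and stationary: "\<And>z \<eta>. z \<in> ball x0 r \<Longrightarrow> p z = 0 \<Longrightarrow> \<eta> > 0 \<Longrightarrow>
      \<exists>\<delta>>0. \<forall>w. p w = 0 \<longrightarrow> dist z w < \<delta> \<longrightarrow> dist (q z) (q w) \<le> \<eta> * dist z w"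
    and x: "p x = 0" and y: "p y = 0" and near: "dist x0 y + dist x y < r"
  shows "q x = q y"
proof -
  have bound: "dist (q x) (q y) \<le> \<eta> * dist x y" if "\<eta> > 0" for \<eta>
  proof -
    \<comment> \<open>\<open>C\<close> budgets the change of \<open>q\<close>: \<open>\<eta>\<close> per unit of progress towards \<open>y\<close>. Being stated relative
      to the starting point \<open>x\<close>, the budget is inherited by every further step.\<close>
    define C where "C = {z. p z = 0 \<and> dist (q x) (q z) \<le> \<eta> * (dist x y - dist z y)}"
    have "closed C"
      unfolding C_def using cont
      by (intro closed_Collect_conj closed_Collect_eq closed_Collect_le continuous_intros)
    moreover have "continuous_on C (\<lambda>z. dist z y)"
      by (intro continuous_intros)
    moreover have "x \<in> C"
      by (simp add: C_def x)
    ultimately obtain z where z: "z \<in> C" "1 / 2 * dist x z \<le> dist x y - dist z y"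
      and stuck: "\<And>w. w \<in> C \<Longrightarrow> 1 / 2 * dist z w \<le> dist z y - dist w y \<Longrightarrow> w = z"
      by (rule ekeland_variational_principle[of C "\<lambda>z. dist z y" x "1 / 2"]) (simp, simp, blast)
    have dist_z: "dist z y \<le> dist x y"
      using z(2) zero_le_dist[of x z] by linarith
    have in_ball: "w \<in> ball x0 r" if "dist w y \<le> dist z y" for w
      using dist_triangle[of x0 w y] that dist_z near by (simp add: dist_commute)
    have "z = y"
    proof (rule ccontr)
      assume "z \<noteq> y"
      define d where "d = y - z"
      have d: "norm d > 0" "dist z y = norm d"
        using \<open>z \<noteq> y\<close> by (auto simp: d_def dist_norm norm_minus_commute)
      have pz: "p z = 0"
        using z by (simp add: C_def)
      have zb: "z \<in> ball x0 r"
        by (rule in_ball) simp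
      have yb: "y \<in> ball x0 r"
        by (rule in_ball) simp
      have segment: "z + t *\<^sub>R (y - z) \<in> ball x0 r" if "t \<in> {0..1}" for t
      proof (rule in_ball)
        have "z + t *\<^sub>R (y - z) - y = (1 - t) *\<^sub>R (z - y)"
          by (simp add: algebra_simps)
        then have "dist (z + t *\<^sub>R (y - z)) y = (1 - t) * dist z y"
          using that by (simp add: dist_norm)
        also have "\<dots> \<le> 1 * dist z y"
          using that by (intro mult_right_mono) auto
        finally show "dist (z + t *\<^sub>R (y - z)) y \<le> dist z y"
          by simp
      qed
      have x0b: "x0 \<in> ball x0 r"
        using zb by (metis centre_in_ball le_less_trans mem_ball zero_le_dist)
      have "norm (p y - p z - blinfun_apply (p' x0) (y - z)) \<le> norm (y - z) * \<epsilon>"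
      proof (rule differentiable_bound_linearization[where S = "ball x0 r"
            and f' = "\<lambda>x. blinfun_apply (p' x)"])
        fix u assume u: "u \<in> ball x0 r"
        show "(p has_derivative blinfun_apply (p' u)) (at u within ball x0 r)"
          using der[OF u] by (rule has_derivative_at_withinI)
        show "onorm (blinfun_apply (p' u) - blinfun_apply (p' x0)) \<le> \<epsilon>"
          using close[OF u] by (simp add: norm_blinfun.rep_eq minus_blinfun.rep_eq fun_diff_def)
      qed (use segment x0b in auto)
      then have "norm (blinfun_apply (p' x0) d) \<le> \<epsilon> * norm d"
        by (simp add: y pz d_def mult.commute)
      moreover have "norm (blinfun_apply (p' z - p' x0) d) \<le> \<epsilon> * norm d"
        using norm_blinfun[of "p' z - p' x0" d] close[OF zb]
        by (smt (verit) mult_right_mono norm_ge_zero)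
      \<comment> \<open>Both ends of \<open>d\<close> lie on the fibre, so \<open>d\<close> is almost tangent to it.\<close>
      ultimately have along: "norm (blinfun_apply (p' z) d) \<le> 2 * \<epsilon> * norm d"
        using norm_triangle_ineq[of "blinfun_apply (p' z - p' x0) d" "blinfun_apply (p' x0) d"]
        by (simp add: blinfun.bilinear_simps)
      obtain \<delta>1 where \<delta>1: "\<delta>1 > 0"
        and lin: "\<And>w. norm (w - z) < \<delta>1 \<Longrightarrow> norm (p w - p z - blinfun_apply (p' z) (w - z)) \<le> \<epsilon> * norm (w - z)"
        using der[OF zb] \<kappa> unfolding has_derivative_at_alt by blast
      obtain \<delta>2 where \<delta>2: "\<delta>2 > 0"
        and stat: "\<And>w. p w = 0 \<Longrightarrow> dist z w < \<delta>2 \<Longrightarrow> dist (q z) (q w) \<le> \<eta> / 2 * dist z w"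
        using stationary[OF zb pz, of "\<eta> / 2"] \<open>\<eta> > 0\<close> by auto
      \<comment> \<open>The corrected step has length at most \<open>5 / 4\<close> times \<open>t * norm d\<close>; hence the bound by \<open>\<delta>2 / 2\<close>.\<close>
      define t where "t = min 1 (min (\<delta>1 / 2) (\<delta>2 / 2) / norm d)"
      have "t > 0"
        using d \<delta>1 \<delta>2 by (simp add: t_def)
      have t: "t \<le> 1" "t * norm d < \<delta>1" "5 / 4 * (t * norm d) < \<delta>2"
        using d \<delta>1 \<delta>2 by (auto simp: t_def min_def field_simps)
      define v where "v = z + t *\<^sub>R d"
      have "v \<in> ball x0 r"
        using segment[of t] \<open>t > 0\<close> t by (simp add: v_def d_def)
      have "norm (p v - t *\<^sub>R blinfun_apply (p' z) d) \<le> \<epsilon> * (t * norm d)"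
        using lin[of v] \<open>t > 0\<close> t by (simp add: v_def pz blinfun.bilinear_simps)
      moreover have "norm (t *\<^sub>R blinfun_apply (p' z) d) \<le> t * (2 * \<epsilon> * norm d)"
        using along \<open>t > 0\<close> by simp
      ultimately have "norm (p v) \<le> 3 * \<epsilon> * (t * norm d)"
        using norm_triangle_sub[of "p v" "t *\<^sub>R blinfun_apply (p' z) d"] by (simp add: algebra_simps)
      then have "\<kappa> * norm (p v) \<le> \<kappa> * (3 * \<epsilon> * (t * norm d))"
        using \<kappa> by (intro mult_left_mono) auto
      also have "\<dots> = (\<kappa> * \<epsilon>) * (3 * (t * norm d))"
        by simp
      also have "\<dots> \<le> 1 / 12 * (3 * (t * norm d))"
        using \<kappa> \<open>t > 0\<close> by (intro mult_right_mono) auto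
      finally obtain w where w: "p w = 0" "dist v w \<le> t * norm d / 4"
        using regular[OF \<open>v \<in> ball x0 r\<close>] by (auto intro: order_trans)
      have "dist z v = t * norm d"
        using \<open>t > 0\<close> by (simp add: v_def dist_norm)
      then have zw: "dist z w \<le> 5 / 4 * (t * norm d)" "dist z w \<ge> 3 / 4 * (t * norm d)"
        using w(2) dist_triangle[of z w v] dist_triangle[of z v w] by (simp_all add: dist_commute)
      have "v - y = (1 - t) *\<^sub>R (z - y)"
        by (simp add: v_def d_def algebra_simps)
      then have "dist v y = (1 - t) * norm d"
        using t d by (simp add: dist_norm)
      then have gain: "dist w y \<le> dist z y - 3 / 4 * (t * norm d)"
        using w(2) dist_triangle[of w y v] d by (simp add: dist_commute algebra_simps)
      have "dist (q x) (q w) \<le> dist (q x) (q z) + \<eta> / 2 * dist z w"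
        using dist_triangle[of "q x" "q w" "q z"] stat[OF w(1)] zw t by (smt (verit))
      also have "\<dots> \<le> \<eta> * (dist x y - dist z y) + \<eta> * (3 / 4 * (t * norm d))"
      proof (rule add_mono)
        show "dist (q x) (q z) \<le> \<eta> * (dist x y - dist z y)"
          using z by (simp add: C_def)
        have "1 / 2 * dist z w \<le> 3 / 4 * (t * norm d)"
          using zw \<open>t > 0\<close> by simp
        from mult_left_mono[OF this, of \<eta>] show "\<eta> / 2 * dist z w \<le> \<eta> * (3 / 4 * (t * norm d))"
          using \<open>\<eta> > 0\<close> by simp
      qed
      also have "\<dots> = \<eta> * (dist x y - dist z y + 3 / 4 * (t * norm d))"
        by (simp add: distrib_left)
      also have "\<dots> \<le> \<eta> * (dist x y - dist w y)"
        using gain \<open>\<eta> > 0\<close> by (intro mult_left_mono) auto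
      finally have "w \<in> C"
        using w by (simp add: C_def)
      moreover have "0 < t * norm d"
        using \<open>t > 0\<close> d by simp
      ultimately have "w = z"
        using stuck zw gain by simp
      then show False
        using zw \<open>0 < t * norm d\<close> by simp
    qed
    then show ?thesis
      using z(1) by (simp add: C_def)
  qed
  have "dist (q x) (q y) \<le> 0 + e" if "e > 0" for e
  proof -
    have "e / (dist x y + 1) > 0"
      using that by (simp add: add_nonneg_pos)
    from bound[OF this] have "dist (q x) (q y) \<le> e * (dist x y / (dist x y + 1))"
      by simp
    also have "\<dots> \<le> e * 1"
      using that by (intro mult_left_mono) (auto simp: divide_le_eq_1 add_nonneg_pos)
    finally show ?thesis by simp
  qed
  then have "dist (q x) (q y) \<le> 0"
    by (rule field_le_epsilon)
  then show ?thesis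
    by simp
qed

text \<open>
  A minimizer of a Lipschitz function on a set with an error bound minimizes, without constraints,
  the function plus \<open>L * \<kappa> * norm (p z)\<close>. The directional derivatives of that sum at \<open>x0\<close>, in the
  directions \<open>h\<close> and \<open>- h\<close>, are nonnegative.
\<close>

lemma minimizer_derivative_dominated:
  fixes p :: "'a::real_normed_vector \<Rightarrow> 'b::real_normed_vector" and f :: "'a \<Rightarrow> real"
  assumes p: "(p has_derivative p') (at x0)" "p x0 = 0"
    and f: "(f has_derivative f') (at x0)"
    and lipschitz: "L-lipschitz_on (ball x0 r) f" and "r > 0"
    and regular: "\<And>z. z \<in> ball x0 r \<Longrightarrow> \<exists>z'. p z' = 0 \<and> dist z z' \<le> \<kappa> * norm (p z)"
    and "\<kappa> > 0"
    and minimal: "\<And>z. z \<in> ball x0 r \<Longrightarrow> p z = 0 \<Longrightarrow> f x0 \<le> f z"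
  shows "\<bar>f' h\<bar> \<le> L * \<kappa> * norm (p' h)"
proof -
  have "L \<ge> 0"
    using lipschitz by (rule lipschitz_on_nonneg)
  interpret p': bounded_linear p'
    using p(1) by (rule has_derivative_bounded_linear)
  interpret f': bounded_linear f'
    using f by (rule has_derivative_bounded_linear)
  have "\<forall>\<^sub>F z in nhds x0. \<kappa> * norm (p z) < r / 2 \<and> dist z x0 < r / 2"
  proof (intro eventually_conj)
    have "isCont p x0"
      using p(1) by (rule has_derivative_continuous)
    then have "isCont (\<lambda>z. \<kappa> * norm (p z)) x0"
      by (intro continuous_intros)
    then have "((\<lambda>z. \<kappa> * norm (p z)) \<longlongrightarrow> 0) (nhds x0)"
      using p(2) tendsto_at_iff_tendsto_nhds[of "\<lambda>z. \<kappa> * norm (p z)" x0] by (simp add: isCont_def)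
    then show "\<forall>\<^sub>F z in nhds x0. \<kappa> * norm (p z) < r / 2"
      using \<open>r > 0\<close> by (intro order_tendstoD(2)) auto
    show "\<forall>\<^sub>F z in nhds x0. dist z x0 < r / 2"
      using \<open>r > 0\<close> unfolding eventually_nhds_metric by (intro exI[of _ "r / 2"]) simp
  qed
  then obtain d where d: "d > 0"
    and small: "\<And>z. dist z x0 < d \<Longrightarrow> \<kappa> * norm (p z) < r / 2 \<and> dist z x0 < r / 2"
    by (auto simp: eventually_nhds_metric)
  \<comment> \<open>Exact penalization: moving \<open>z\<close> to the nearby zero of \<open>p\<close> costs at most the penalty term.\<close>
  have penalty: "f x0 \<le> f z + L * \<kappa> * norm (p z)" if "dist z x0 < d" for z
  proof -
    have zb: "z \<in> ball x0 r"
      using small[OF that] \<open>r > 0\<close> by (simp add: dist_commute)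
    then obtain w where w: "p w = 0" "dist z w \<le> \<kappa> * norm (p z)"
      using regular by blast
    then have wb: "w \<in> ball x0 r"
      using small[OF that] dist_triangle[of x0 w z] by (simp add: dist_commute)
    have "f w - f z \<le> L * dist z w"
      using lipschitz_onD[OF lipschitz zb wb] by (simp add: dist_real_def)
    also have "\<dots> \<le> L * (\<kappa> * norm (p z))"
      using w \<open>L \<ge> 0\<close> by (intro mult_left_mono)
    finally show ?thesis
      using minimal[OF wb w(1)] by simp
  qed
  have lower: "0 \<le> f' h + L * \<kappa> * norm (p' h)" for h
  proof (cases "h = 0")
    case True
    then show ?thesis
      by (simp add: f'.zero p'.zero)
  next
    case False
    have "0 \<le> f' h + L * \<kappa> * norm (p' h) + e" if "e > 0" for e
    proof -
      define \<eta> where "\<eta> = e / ((1 + L * \<kappa>) * norm h)"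
      have pos: "0 < 1 + L * \<kappa>"
        using \<open>L \<ge> 0\<close> \<open>\<kappa> > 0\<close> by (simp add: add_pos_nonneg)
      then have "\<eta> > 0"
        using False that by (simp add: \<eta>_def)
      obtain d1 where d1: "d1 > 0"
        "\<And>w. norm (w - x0) < d1 \<Longrightarrow> norm (p w - p x0 - p' (w - x0)) \<le> \<eta> * norm (w - x0)"
        using p \<open>\<eta> > 0\<close> unfolding has_derivative_at_alt by blast
      obtain d2 where d2: "d2 > 0"
        "\<And>w. norm (w - x0) < d2 \<Longrightarrow> norm (f w - f x0 - f' (w - x0)) \<le> \<eta> * norm (w - x0)"
        using f \<open>\<eta> > 0\<close> unfolding has_derivative_at_alt by blast
      define t where "t = min d (min d1 d2) / (2 * norm h)"
      have "t > 0" and t: "t * norm h < d" "t * norm h < d1" "t * norm h < d2"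
        using d d1 d2 False by (auto simp: t_def)
      define w where "w = x0 + t *\<^sub>R h"
      have "norm (p w - t *\<^sub>R p' h) \<le> \<eta> * (t * norm h)"
        using d1(2)[of w] t \<open>t > 0\<close> by (simp add: w_def p(2) p'.scaleR)
      then have "norm (p w) \<le> t * norm (p' h) + \<eta> * (t * norm h)"
        using norm_triangle_sub[of "p w" "t *\<^sub>R p' h"] \<open>t > 0\<close> by simp
      then have "L * \<kappa> * norm (p w) \<le> L * \<kappa> * (t * norm (p' h) + \<eta> * (t * norm h))"
        using \<open>L \<ge> 0\<close> \<open>\<kappa> > 0\<close> by (intro mult_left_mono) auto
      moreover have "f w - f x0 \<le> t * f' h + \<eta> * (t * norm h)"
        using d2(2)[of w] t \<open>t > 0\<close> by (simp add: w_def f'.scaleR)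
      moreover have "f x0 \<le> f w + L * \<kappa> * norm (p w)"
        using t \<open>t > 0\<close> by (intro penalty) (simp add: w_def dist_norm)
      ultimately have "0 \<le> t * (f' h + L * \<kappa> * norm (p' h) + \<eta> * ((1 + L * \<kappa>) * norm h))"
        by (simp add: algebra_simps)
      then have "0 \<le> f' h + L * \<kappa> * norm (p' h) + \<eta> * ((1 + L * \<kappa>) * norm h)"
        using \<open>t > 0\<close> by (simp add: zero_le_mult_iff)
      then show ?thesis
        using pos False by (simp add: \<eta>_def)
    qed
    then show ?thesis
      by (rule field_le_epsilon)
  qed
  show ?thesis
    using lower[of h] lower[of "- h"] by (simp add: f'.neg p'.neg abs_le_iff)
qed

section \<open>Schauder bases and the sequence space\<close>

lemma families_UNIV [simp]: "families UNIV = UNIV"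
  by (simp add: families_def)

lemma schauder_basis_expansion:
  assumes "schauder_basis J v X" "x \<in> X"
  shows "(\<lambda>i. biorthogonal J v X i x) \<in> families J"
    and "(\<lambda>i. biorthogonal J v X i x *\<^sub>R v i) sums x"
proof -
  have "\<exists>!a. a \<in> families J \<and> (\<lambda>i. a i *\<^sub>R v i) sums x"
    using assms by (simp add: schauder_basis_def)
  from theI'[OF this] show "(\<lambda>i. biorthogonal J v X i x) \<in> families J"
    and "(\<lambda>i. biorthogonal J v X i x *\<^sub>R v i) sums x"
    using assms(2) by (simp_all add: biorthogonal_def)
qed

lemma biorthogonal_eqI:
  assumes "schauder_basis J v X" "x \<in> X" "a \<in> families J" "(\<lambda>i. a i *\<^sub>R v i) sums x"
  shows "biorthogonal J v X i x = a i"
proof -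
  have "\<exists>!a. a \<in> families J \<and> (\<lambda>i. a i *\<^sub>R v i) sums x"
    using assms by (simp add: schauder_basis_def)
  then have "(\<lambda>i. biorthogonal J v X i x) = a"
    using schauder_basis_expansion[OF assms(1,2)] assms(3,4) by blast
  then show ?thesis
    by (rule fun_cong)
qed

lemma biorthogonal_basis_vector:
  assumes "schauder_basis J v X" "j \<in> J"
  shows "biorthogonal J v X i (v j) = (if i = j then 1 else 0)"
proof (rule biorthogonal_eqI[OF assms(1)])
  show "v j \<in> X"
    using assms by (simp add: schauder_basis_def)
  show "(\<lambda>i. if i = j then 1 else 0) \<in> families J"
    using assms by (auto simp: families_def)
  show "(\<lambda>i. (if i = j then 1 else 0) *\<^sub>R v i) sums v j"
    using sums_single[of j v] by (simp add: if_distrib[of "\<lambda>c. c *\<^sub>R _"] cong: if_cong)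
qed

lemma schauder_basis_nonzero:
  assumes "schauder_basis J v X" "j \<in> J"
  shows "v j \<noteq> 0"
proof
  assume "v j = 0"
  moreover have "0 \<in> X"
    using assms(1) by (simp add: schauder_basis_def subspace_0)
  then have "biorthogonal J v X j 0 = 0"
    using biorthogonal_eqI[OF assms(1), of 0 "\<lambda>_. 0"] by (simp add: families_def)
  ultimately show False
    using biorthogonal_basis_vector[OF assms, of j] by simp
qed

lemma partial_sum_le_Y_norm:
  assumes "summable (\<lambda>i. a i *\<^sub>R b i)"
  shows "norm (\<Sum>i<N. a i *\<^sub>R b i) \<le> Y_norm b a"
proof -
  have "bounded (range (\<lambda>N. norm (\<Sum>i<N. a i *\<^sub>R b i)))"
    by (rule convergent_imp_bounded[OF tendsto_norm[OF summable_LIMSEQ[OF assms]]])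
  then show ?thesis
    unfolding Y_norm_def by (intro cSUP_upper bounded_imp_bdd_above) auto
qed

lemma Y_norm_le:
  assumes "\<And>N. norm (\<Sum>i<N. a i *\<^sub>R b i) \<le> B"
  shows "Y_norm b a \<le> B"
  unfolding Y_norm_def using assms by (intro cSUP_least) auto

lemma Y_norm_nonneg: "summable (\<lambda>i. a i *\<^sub>R b i) \<Longrightarrow> 0 \<le> Y_norm b a"
  using partial_sum_le_Y_norm[of a b 0] by simp

lemma term_le_Y_norm:
  assumes "summable (\<lambda>i. a i *\<^sub>R b i)"
  shows "norm (a i *\<^sub>R b i) \<le> 2 * Y_norm b a"
proof -
  have "a i *\<^sub>R b i = (\<Sum>j<Suc i. a j *\<^sub>R b j) - (\<Sum>j<i. a j *\<^sub>R b j)"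
    by simp
  then show ?thesis
    using norm_triangle_ineq4[of "\<Sum>j<Suc i. a j *\<^sub>R b j" "\<Sum>j<i. a j *\<^sub>R b j"]
      partial_sum_le_Y_norm[OF assms, of "Suc i"] partial_sum_le_Y_norm[OF assms, of i] by simp
qed

lemma Y_norm_scale:
  assumes a: "summable (\<lambda>i. a i *\<^sub>R b i)"
  shows "Y_norm b (\<lambda>i. c * a i) = \<bar>c\<bar> * Y_norm b a"
proof -
  have le: "Y_norm b (\<lambda>i. c * a i) \<le> \<bar>c\<bar> * Y_norm b a" if "summable (\<lambda>i. a i *\<^sub>R b i)" for a c
  proof (rule Y_norm_le)
    fix N
    have "(\<Sum>i<N. (c * a i) *\<^sub>R b i) = c *\<^sub>R (\<Sum>i<N. a i *\<^sub>R b i)"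
      by (simp add: scaleR_sum_right)
    then show "norm (\<Sum>i<N. (c * a i) *\<^sub>R b i) \<le> \<bar>c\<bar> * Y_norm b a"
      using partial_sum_le_Y_norm[OF that] by (simp add: mult_left_mono)
  qed
  show ?thesis
  proof (cases "c = 0")
    case True
    then show ?thesis
      by (simp add: Y_norm_def)
  next
    case False
    have "summable (\<lambda>i. (c * a i) *\<^sub>R b i)"
      using summable_scaleR_right[OF a, of c] by simp
    from le[OF this, of "1 / c"] have "\<bar>c\<bar> * Y_norm b a \<le> Y_norm b (\<lambda>i. c * a i)"
      using False by (simp add: field_simps)
    then show ?thesis
      using le[OF a, of c] by simp
  qed
qed

text \<open>
  Nonzero basis vectors are what makes \<open>Y_dist\<close> separate points.
\<close>

lemma Metric_space_Y:
  assumes "\<And>i. i \<in> J \<Longrightarrow> b i \<noteq> 0"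
  shows "Metric_space (Y_space b J) (Y_dist b J)"
proof
  have diff: "summable (\<lambda>i. (c i - d i) *\<^sub>R b i)" if "c \<in> Y_space b J" "d \<in> Y_space b J" for c d
    using that summable_diff[of "\<lambda>i. c i *\<^sub>R b i" "\<lambda>i. d i *\<^sub>R b i"]
    by (simp add: Y_space_def scaleR_diff_left)
  fix c d
  show "0 \<le> Y_dist b J c d"
    using Y_norm_nonneg[OF diff] by (auto simp: Y_dist_def)
  show "Y_dist b J c d = Y_dist b J d c"
    using Y_norm_scale[OF diff, of c d "-1"] by (auto simp: Y_dist_def)
  show "Y_dist b J c d = 0 \<longleftrightarrow> c = d" if cd: "c \<in> Y_space b J" "d \<in> Y_space b J"
  proof
    assume "Y_dist b J c d = 0"
    then have "(c i - d i) *\<^sub>R b i = 0" for i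
      using term_le_Y_norm[OF diff[OF cd], of i] cd by (simp add: Y_dist_def del: norm_scaleR)
    then have "c i = d i" for i
      using assms[of i] cd by (cases "i \<in> J") (auto simp: Y_space_def families_def)
    then show "c = d" ..
  next
    assume "c = d"
    then show "Y_dist b J c d = 0"
      by (simp add: Y_dist_def Y_norm_def)
  qed
  fix e assume *: "c \<in> Y_space b J" "d \<in> Y_space b J" "e \<in> Y_space b J"
  have "Y_norm b (\<lambda>i. c i - e i) \<le> Y_norm b (\<lambda>i. c i - d i) + Y_norm b (\<lambda>i. d i - e i)"
  proof (rule Y_norm_le)
    fix N
    have "(\<Sum>i<N. (c i - e i) *\<^sub>R b i) = (\<Sum>i<N. (c i - d i) *\<^sub>R b i) + (\<Sum>i<N. (d i - e i) *\<^sub>R b i)"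
      by (simp add: scaleR_diff_left sum_subtractf)
    then show "norm (\<Sum>i<N. (c i - e i) *\<^sub>R b i) \<le> Y_norm b (\<lambda>i. c i - d i) + Y_norm b (\<lambda>i. d i - e i)"
      by (simp only:) (intro norm_triangle_le add_mono partial_sum_le_Y_norm diff *)
  qed
  then show "Y_dist b J c e \<le> Y_dist b J c d + Y_dist b J d e"
    using * by (simp add: Y_dist_def)
qed

text \<open>
  The tails of a convergent series are small in the norm of \<open>Y\<close>, so finite families are dense.
\<close>

lemma closed_subset_Y_space_full:
  assumes b: "\<And>i. i \<in> J \<Longrightarrow> b i \<noteq> 0"
    and closed: "closedin (Metric_space.mtopology (Y_space b J) (Y_dist b J)) S"
    and truncations: "\<And>c N. c \<in> families J \<Longrightarrow> (\<lambda>i. if i < N then c i else 0) \<in> S"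
  shows "Y_space b J \<subseteq> S"
proof
  interpret Y: Metric_space "Y_space b J" "Y_dist b J"
    using b by (rule Metric_space_Y)
  fix c assume c: "c \<in> Y_space b J"
  define trunc where "trunc N i = (if i < N then c i else 0)" for N i
  have fam: "trunc N \<in> families J" for N
    using c by (auto simp: trunc_def Y_space_def families_def)
  have sums: "(\<lambda>i. c i *\<^sub>R b i) sums (\<Sum>i. c i *\<^sub>R b i)"
    using c by (simp add: Y_space_def summable_sums)
  have in_Y: "trunc N \<in> Y_space b J" for N
    using fam summable_finite[of "{..<N}" "\<lambda>i. trunc N i *\<^sub>R b i"]
    by (auto simp: Y_space_def trunc_def[of N])
  have dist: "Y_dist b J (trunc N) c \<le> e"
    if small: "\<And>m. m \<ge> N \<Longrightarrow> norm ((\<Sum>i<m. c i *\<^sub>R b i) - (\<Sum>i<N. c i *\<^sub>R b i)) \<le> e" for N e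
  proof -
    have "Y_norm b (\<lambda>i. trunc N i - c i) \<le> e"
    proof (rule Y_norm_le)
      fix m
      show "norm (\<Sum>i<m. (trunc N i - c i) *\<^sub>R b i) \<le> e"
      proof (cases "m \<le> N")
        case True
        then have "(\<Sum>i<m. (trunc N i - c i) *\<^sub>R b i) = 0"
          by (intro sum.neutral) (auto simp: trunc_def)
        then show ?thesis
          using small[of N] by simp
      next
        case False
        have "(\<Sum>i<m. trunc N i *\<^sub>R b i) = (\<Sum>i<N. c i *\<^sub>R b i)"
          using False by (intro sum.mono_neutral_cong_right) (auto simp: trunc_def)
        then show ?thesis
          using small[of m] False by (simp add: scaleR_diff_left sum_subtractf norm_minus_commute)
      qed
    qed
    then show ?thesis
      using c in_Y by (simp add: Y_dist_def)
  qed
  have "(\<lambda>N. Y_dist b J (trunc N) c) \<longlonglongrightarrow> 0"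
  proof (rule tendstoI)
    fix e :: real assume "e > 0"
    have "Cauchy (\<lambda>N. \<Sum>i<N. c i *\<^sub>R b i)"
      using sums by (auto simp: sums_def intro: LIMSEQ_imp_Cauchy)
    then have "\<exists>M. \<forall>m\<ge>M. \<forall>n\<ge>M. norm ((\<Sum>i<m. c i *\<^sub>R b i) - (\<Sum>i<n. c i *\<^sub>R b i)) < e / 2"
      by (rule CauchyD) (use \<open>e > 0\<close> in simp)
    then obtain M where "\<And>m n. m \<ge> M \<Longrightarrow> n \<ge> M \<Longrightarrow>
        norm ((\<Sum>i<m. c i *\<^sub>R b i) - (\<Sum>i<n. c i *\<^sub>R b i)) < e / 2"
      by blast
    then have "Y_dist b J (trunc N) c \<le> e / 2" if "N \<ge> M" for N
      using that by (intro dist) (auto intro: less_imp_le)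
    then have "\<forall>N\<ge>M. dist (Y_dist b J (trunc N) c) 0 < e"
      using \<open>e > 0\<close> by (simp add: dist_real_def le_less_trans[of _ "e / 2"])
    then show "\<forall>\<^sub>F N in sequentially. dist (Y_dist b J (trunc N) c) 0 < e"
      unfolding eventually_sequentially by blast
  qed
  then have "limitin Y.mtopology trunc c sequentially"
    using c in_Y by (simp add: Y.limitin_metric_dist_null)
  moreover have "range trunc \<subseteq> S"
    using truncations c by (auto simp: trunc_def[abs_def] Y_space_def)
  ultimately show "c \<in> S"
    using closed unfolding Y.metric_closedin_iff_sequentially_closed by blast
qed

section \<open>Coordinates with respect to a Besselian and Hilbertian basis\<close>

abbreviation coordinate :: "(nat \<Rightarrow> 'f::banach) \<Rightarrow> nat \<Rightarrow> 'f \<Rightarrow> real"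
  where "coordinate b \<equiv> biorthogonal UNIV b UNIV"

text \<open>
  The norm of \<open>Y\<close>, applied to the coordinates of a vector, is a countably subadditive seminorm; by
  Zabreiko's lemma it is bounded, and it bounds each coordinate.
\<close>

lemma bounded_linear_coordinate:
  assumes basis: "schauder_basis UNIV b UNIV"
  shows "bounded_linear (coordinate b i)"
proof -
  have expansion: "(\<lambda>i. coordinate b i y *\<^sub>R b i) sums y" for y
    using schauder_basis_expansion(2)[OF basis] by simp
  have eqI: "coordinate b i y = a i" if "(\<lambda>i. a i *\<^sub>R b i) sums y" for a y i
    using biorthogonal_eqI[OF basis _ _ that] by simp
  have scale: "coordinate b i (t *\<^sub>R y) = t * coordinate b i y" for t y i
    using eqI[of "\<lambda>i. t * coordinate b i y" "t *\<^sub>R y" i] sums_scaleR_right[OF expansion[of y], of t] by simp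
  have add: "coordinate b i (y + z) = coordinate b i y + coordinate b i z" for y z :: 'a and i
    using eqI[of "\<lambda>i. coordinate b i y + coordinate b i z" "y + z" i] sums_add[OF expansion[of y] expansion[of z]]
    by (simp add: scaleR_add_left)
  note summ = sums_summable[OF expansion]
  define s where "s y = Y_norm b (\<lambda>i. coordinate b i y)" for y
  have partial: "norm (\<Sum>i<N. coordinate b i y *\<^sub>R b i) \<le> s y" for N y
    unfolding s_def by (rule partial_sum_le_Y_norm[OF summ])
  have coord: "\<bar>coordinate b i y\<bar> \<le> 2 / norm (b i) * s y" for i y
    using term_le_Y_norm[OF summ[of y], of i] schauder_basis_nonzero[OF basis, of i]
    by (simp add: s_def field_simps)
  have "\<exists>K>0. \<forall>y. s y \<le> K * norm y"
  proof (rule countably_subadditive_seminorm_bounded)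
    show "s (t *\<^sub>R y) = \<bar>t\<bar> * s y" for t y
      unfolding s_def scale by (rule Y_norm_scale[OF summ])
    fix u y assume u: "u sums y" and su: "summable (\<lambda>n. s (u n))"
    define a where "a i = (\<Sum>n. coordinate b i (u n))" for i
    have sa: "(\<lambda>n. coordinate b i (u n)) sums a i" for i
    proof -
      have "summable (\<lambda>n. coordinate b i (u n))"
        by (rule summable_comparison_test'[OF summable_mult[OF su, of "2 / norm (b i)"], of 0])
          (unfold real_norm_def, rule coord)
      then show ?thesis
        unfolding a_def by (rule summable_sums)
    qed
    have psums: "(\<lambda>n. \<Sum>i<N. coordinate b i (u n) *\<^sub>R b i) sums (\<Sum>i<N. a i *\<^sub>R b i)" for N
      by (intro sums_sum sums_scaleR_left sa)
    \<comment> \<open>The two limits may be exchanged, because \<open>s (u n)\<close> bounds the partial sums uniformly in \<open>N\<close>.\<close>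
    have "(\<lambda>N. \<Sum>n. \<Sum>i<N. coordinate b i (u n) *\<^sub>R b i) \<longlonglongrightarrow> (\<Sum>n. u n)"
    proof (rule swap_uniform_limit')
      show "\<forall>\<^sub>F M in sequentially.
          (\<lambda>N. \<Sum>n<M. \<Sum>i<N. coordinate b i (u n) *\<^sub>R b i) \<longlonglongrightarrow> (\<Sum>n<M. u n)"
        using expansion by (intro always_eventually allI tendsto_sum) (simp add: sums_def)
      show "(\<lambda>M. \<Sum>n<M. u n) \<longlonglongrightarrow> (\<Sum>n. u n)"
        using u by (intro summable_LIMSEQ sums_summable)
      show "uniform_limit UNIV (\<lambda>M N. \<Sum>n<M. \<Sum>i<N. coordinate b i (u n) *\<^sub>R b i)
          (\<lambda>N. \<Sum>n. \<Sum>i<N. coordinate b i (u n) *\<^sub>R b i) sequentially"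
        by (rule Weierstrass_m_test[where M = "\<lambda>n. s (u n)"]) (rule partial, rule su)
    qed auto
    then have "(\<lambda>i. a i *\<^sub>R b i) sums y"
      unfolding sums_def by (simp only: sums_unique[OF psums, symmetric] sums_unique[OF u, symmetric])
    then have a: "a i = coordinate b i y" for i
      using eqI by simp
    show "s y \<le> (\<Sum>n. s (u n))"
      unfolding s_def[of y]
    proof (rule Y_norm_le)
      fix N
      have sn: "summable (\<lambda>n. norm (\<Sum>i<N. coordinate b i (u n) *\<^sub>R b i))"
        using partial by (intro summable_comparison_test'[OF su]) auto
      have "norm (\<Sum>i<N. coordinate b i y *\<^sub>R b i) \<le> (\<Sum>n. norm (\<Sum>i<N. coordinate b i (u n) *\<^sub>R b i))"
        using summable_norm[OF sn] sums_unique[OF psums[of N]] by (simp add: a)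
      also have "\<dots> \<le> (\<Sum>n. s (u n))"
        using partial by (intro suminf_le sn su)
      finally show "norm (\<Sum>i<N. coordinate b i y *\<^sub>R b i) \<le> (\<Sum>n. s (u n))" .
    qed
  qed
  then obtain K where K: "\<And>y. s y \<le> K * norm y"
    by blast
  show ?thesis
  proof (rule bounded_linear_intro)
    fix y
    have "\<bar>coordinate b i y\<bar> \<le> 2 / norm (b i) * (K * norm y)"
      using coord[of i y] K[of y] by (smt (verit) divide_nonneg_nonneg mult_left_mono norm_ge_zero)
    then show "norm (coordinate b i y) \<le> norm y * (2 / norm (b i) * K)"
      by (simp add: mult_ac)
  qed (simp_all add: add scale)
qed

lemma coordinates_eqI:
  assumes "schauder_basis UNIV b UNIV" "\<And>i. coordinate b i y = coordinate b i z"
  shows "y = z"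
proof (rule sums_unique2)
  show "(\<lambda>i. coordinate b i z *\<^sub>R b i) sums y"
    using schauder_basis_expansion(2)[OF assms(1), of y] assms(2) by simp
  show "(\<lambda>i. coordinate b i z *\<^sub>R b i) sums z"
    using schauder_basis_expansion(2)[OF assms(1)] by simp
qed

definition coordinate_projection :: "(nat \<Rightarrow> 'f::banach) \<Rightarrow> nat set \<Rightarrow> 'f \<Rightarrow> 'f"
  where "coordinate_projection b J y = (\<Sum>i. (if i \<in> J then coordinate b i y else 0) *\<^sub>R b i)"

text \<open>
  The Besselian property makes the coordinates square summable, deleting some of them preserves this,
  and the Hilbertian property turns square summability back into convergence.
\<close>

lemma coordinate_projection_sums:
  assumes "besselian UNIV b UNIV" "hilbertian UNIV b UNIV"
  shows "(\<lambda>i. (if i \<in> J then coordinate b i y else 0) *\<^sub>R b i) sums coordinate_projection b J y"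
proof -
  have basis: "schauder_basis UNIV b UNIV"
    using assms by (simp add: besselian_def)
  have "summable (\<lambda>i. (coordinate b i y)\<^sup>2)"
    using assms(1) sums_summable[OF schauder_basis_expansion(2)[OF basis], of y]
    by (simp add: besselian_def)
  then have "summable (\<lambda>i. (if i \<in> J then coordinate b i y else 0)\<^sup>2)"
    by (rule summable_comparison_test') auto
  then have "summable (\<lambda>i. (if i \<in> J then coordinate b i y else 0) *\<^sub>R b i)"
    using assms(2) by (simp add: hilbertian_def)
  then show ?thesis
    unfolding coordinate_projection_def by (rule summable_sums)
qed

lemma coordinate_of_projection:
  assumes "besselian UNIV b UNIV" "hilbertian UNIV b UNIV"
  shows "coordinate b i (coordinate_projection b J y) = (if i \<in> J then coordinate b i y else 0)"
  using biorthogonal_eqI[OF _ _ _ coordinate_projection_sums[OF assms], of UNIV UNIV J y i] assms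
  by (simp add: besselian_def)

text \<open>
  A closed graph argument: coordinates are continuous and determine the vector.
\<close>

lemma bounded_linear_coordinate_projection:
  assumes bh: "besselian UNIV b UNIV" "hilbertian UNIV b UNIV"
  shows "bounded_linear (coordinate_projection b J)"
proof -
  let ?P = "coordinate_projection b J"
  have basis: "schauder_basis UNIV b UNIV"
    using bh by (simp add: besselian_def)
  note coord = coordinate_of_projection[OF bh]
  interpret c: bounded_linear "coordinate b i" for i
    using basis by (rule bounded_linear_coordinate)
  have add: "?P (y + z) = ?P y + ?P z" for y z
    by (rule coordinates_eqI[OF basis]) (simp add: coord c.add)
  have scale: "?P (t *\<^sub>R y) = t *\<^sub>R ?P y" for t y
    by (rule coordinates_eqI[OF basis]) (simp add: coord c.scaleR)
  have "\<exists>K>0. \<forall>y. norm (?P y) \<le> K * norm y"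
  proof (rule countably_subadditive_seminorm_bounded)
    show "norm (?P (t *\<^sub>R y)) = \<bar>t\<bar> * norm (?P y)" for t y
      by (simp add: scale)
    fix u y assume u: "u sums y" and su: "summable (\<lambda>n. norm (?P (u n)))"
    have "coordinate b i (\<Sum>n. ?P (u n)) = coordinate b i (?P y)" for i
    proof -
      have "coordinate b i (\<Sum>n. ?P (u n)) = (\<Sum>n. coordinate b i (?P (u n)))"
        using summable_norm_cancel[OF su] by (rule c.suminf)
      also have "\<dots> = coordinate b i (?P y)"
        using sums_unique[OF c.sums[OF u]] by (simp add: coord)
      finally show ?thesis .
    qed
    then have "?P y = (\<Sum>n. ?P (u n))"
      using coordinates_eqI[OF basis] by metis
    then show "norm (?P y) \<le> (\<Sum>n. norm (?P (u n)))"
      using summable_norm[OF su] by simp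
  qed
  then obtain K where "\<And>y. norm (?P y) \<le> K * norm y"
    by blast
  then show ?thesis
    by (intro bounded_linear_intro[where K = K]) (simp_all add: add scale mult.commute)
qed

section \<open>Derivatives of the constraints\<close>

lemma fderiv_eqI:
  assumes "(f has_derivative f') (at x)"
  shows "blinfun_apply (fderiv f x) = f'"
  unfolding fderiv_def frechet_derivative_at[OF assms, symmetric]
  using assms by (intro bounded_linear_Blinfun_apply has_derivative_bounded_linear)

lemma class_C1_has_derivative:
  assumes "class_C1 f"
  shows "(f has_derivative blinfun_apply (fderiv f x)) (at x)"
proof -
  have "(f has_derivative frechet_derivative f (at x)) (at x)"
    using assms by (simp add: class_C1_def frechet_derivative_works)
  then show ?thesis
    using fderiv_eqI by metis
qed

lemma class_C1_near:
  assumes "class_C1 f" "e > 0"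
  shows "\<forall>\<^sub>F x in nhds x0. norm (fderiv f x - fderiv f x0) < e"
proof -
  have "isCont (fderiv f) x0"
    using assms(1) by (simp add: class_C1_def continuous_on_eq_continuous_at)
  then have "(fderiv f \<longlongrightarrow> fderiv f x0) (nhds x0)"
    using tendsto_at_iff_tendsto_nhds[of "fderiv f" x0] by (simp add: isCont_def)
  then show ?thesis
    using tendstoD[of "fderiv f" _ "nhds x0" e] \<open>e > 0\<close> by (simp add: dist_norm)
qed

text \<open>
  A partial sum of the expansion of \<open>\<phi>\<close> approximates it up to \<open>\<eta>\<close> in norm, and finitely many basis
  functionals are dominated jointly. The constant \<open>M\<close> depends on \<open>\<eta>\<close>.
\<close>

lemma dominated_by_basis:
  fixes D :: "nat \<Rightarrow> 'a::real_normed_vector \<Rightarrow>\<^sub>L real"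
  assumes basis: "schauder_basis J D X" and "\<phi> \<in> X"
    and bound: "\<And>j. j \<in> J \<Longrightarrow> \<exists>C. \<forall>h. \<bar>blinfun_apply (D j) h\<bar> \<le> C * norm (A h)"
    and "\<eta> > 0"
  shows "\<exists>M. \<forall>h. \<bar>blinfun_apply \<phi> h\<bar> \<le> M * norm (A h) + \<eta> * norm h"
proof -
  define a where "a i = biorthogonal J D X i \<phi>" for i
  have a: "a i = 0" if "i \<notin> J" for i
    using schauder_basis_expansion(1)[OF assms(1,2)] that by (simp add: a_def families_def)
  have "(\<lambda>N. \<Sum>i<N. a i *\<^sub>R D i) \<longlonglongrightarrow> \<phi>"
    using schauder_basis_expansion(2)[OF assms(1,2)] by (simp add: a_def sums_def)
  then obtain N where N: "norm ((\<Sum>i<N. a i *\<^sub>R D i) - \<phi>) < \<eta>"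
    using \<open>\<eta> > 0\<close> LIMSEQ_D[of _ \<phi> \<eta>] by blast
  have "\<forall>j. \<exists>C. j \<in> J \<longrightarrow> (\<forall>h. \<bar>blinfun_apply (D j) h\<bar> \<le> C * norm (A h))"
    using bound by blast
  then obtain C where C: "\<And>j h. j \<in> J \<Longrightarrow> \<bar>blinfun_apply (D j) h\<bar> \<le> C j * norm (A h)"
    by metis
  have "\<bar>blinfun_apply \<phi> h\<bar> \<le> (\<Sum>i<N. \<bar>a i\<bar> * C i) * norm (A h) + \<eta> * norm h" for h
  proof -
    have "\<bar>blinfun_apply (\<Sum>i<N. a i *\<^sub>R D i) h\<bar> \<le> (\<Sum>i<N. \<bar>a i * blinfun_apply (D i) h\<bar>)"
      by (simp add: blinfun.sum_left blinfun.scaleR_left)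
    also have "\<dots> \<le> (\<Sum>i<N. \<bar>a i\<bar> * (C i * norm (A h)))"
    proof (rule sum_mono)
      fix i
      show "\<bar>a i * blinfun_apply (D i) h\<bar> \<le> \<bar>a i\<bar> * (C i * norm (A h))"
        using C[of i h] a[of i] by (cases "i \<in> J") (auto simp: abs_mult intro: mult_left_mono)
    qed
    also have "\<dots> = (\<Sum>i<N. \<bar>a i\<bar> * C i) * norm (A h)"
      by (simp add: sum_distrib_right mult.assoc)
    finally have "\<bar>blinfun_apply (\<Sum>i<N. a i *\<^sub>R D i) h\<bar> \<le> (\<Sum>i<N. \<bar>a i\<bar> * C i) * norm (A h)" .
    moreover have "\<bar>blinfun_apply ((\<Sum>i<N. a i *\<^sub>R D i) - \<phi>) h\<bar> \<le> \<eta> * norm h"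
      using norm_blinfun[of "(\<Sum>i<N. a i *\<^sub>R D i) - \<phi>" h] N
      by (smt (verit) mult_right_mono norm_ge_zero real_norm_def)
    ultimately show ?thesis
      by (simp add: blinfun.diff_left)
  qed
  then show ?thesis
    by blast
qed

text \<open>
  The biorthogonal functionals are evaluations at points of the domain, and linear combinations of
  these points are mapped to all finite families. As the range is closed, it is the whole space
  \<open>Y(J)\<close>.
\<close>

lemma constraint_coordinates_surjective:
  fixes A :: "'e::banach \<Rightarrow>\<^sub>L 'f::banach" and v :: "nat \<Rightarrow> 'e \<Rightarrow>\<^sub>L real"
  assumes bh: "besselian UNIV b UNIV" "hilbertian UNIV b UNIV"
    and v: "\<And>i h. blinfun_apply (v i) h = coordinate b i (blinfun_apply A h)"
    and basis: "schauder_basis J v X"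
    and closed: "closedin (Metric_space.mtopology (Y_space b J) (Y_dist b J))
      (range (\<lambda>e i. if i \<in> J then blinfun_apply (v i) e else 0))"
    and evaluation: "\<And>i. i \<in> J \<Longrightarrow> \<exists>e. \<forall>\<phi>\<in>X. biorthogonal J v X i \<phi> = blinfun_apply \<phi> e"
  shows "range (coordinate_projection b J) \<subseteq> range (coordinate_projection b J \<circ> blinfun_apply A)"
proof -
  let ?S = "range (\<lambda>e i. if i \<in> J then blinfun_apply (v i) e else 0)"
  have basis_b: "schauder_basis UNIV b UNIV"
    using bh by (simp add: besselian_def)
  have "\<forall>i. \<exists>e. i \<in> J \<longrightarrow> (\<forall>\<phi>\<in>X. biorthogonal J v X i \<phi> = blinfun_apply \<phi> e)"
    using evaluation by blast
  then obtain e where e: "\<And>i \<phi>. i \<in> J \<Longrightarrow> \<phi> \<in> X \<Longrightarrow> biorthogonal J v X i \<phi> = blinfun_apply \<phi> (e i)"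
    by metis
  have dual: "blinfun_apply (v k) (e i) = (if i = k then 1 else 0)" if "i \<in> J" "k \<in> J" for i k
    using e[OF that(1), of "v k"] biorthogonal_basis_vector[OF basis that(2), of i] basis that
    by (simp add: schauder_basis_def)
  have "Y_space b J \<subseteq> ?S"
  proof (rule closed_subset_Y_space_full[OF _ closed])
    show "b i \<noteq> 0" for i
      using basis_b by (rule schauder_basis_nonzero) simp
    fix c N assume c: "c \<in> families J"
    define h where "h = (\<Sum>i<N. c i *\<^sub>R e i)"
    have "blinfun_apply (v k) h = (if k < N then c k else 0)" if "k \<in> J" for k
    proof -
      have "blinfun_apply (v k) h = (\<Sum>i<N. c i * blinfun_apply (v k) (e i))"
        by (simp add: h_def blinfun.bilinear_simps blinfun.sum_right)
      also have "\<dots> = (\<Sum>i<N. if i = k then c k else 0)"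
      proof (rule sum.cong)
        show "c i * blinfun_apply (v k) (e i) = (if i = k then c k else 0)" for i
          using c dual[OF _ that, of i] by (cases "i \<in> J") (auto simp: families_def)
      qed simp
      finally show ?thesis
        by simp
    qed
    then have "(\<lambda>i. if i < N then c i else 0) = (\<lambda>i. if i \<in> J then blinfun_apply (v i) h else 0)"
      using c by (auto simp: families_def)
    then show "(\<lambda>i. if i < N then c i else 0) \<in> ?S"
      by blast
  qed
  moreover have "(\<lambda>i. if i \<in> J then coordinate b i y else 0) \<in> Y_space b J" for y
    using sums_summable[OF coordinate_projection_sums[OF bh, of J y]]
    by (simp add: Y_space_def families_def)
  ultimately have onto: "(\<lambda>i. if i \<in> J then coordinate b i y else 0) \<in> ?S" for y
    by blast
  show ?thesis
  proof clarify
    fix y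
    obtain h where "(\<lambda>i. if i \<in> J then coordinate b i y else 0) =
        (\<lambda>i. if i \<in> J then blinfun_apply (v i) h else 0)"
      using onto[of y] by blast
    then have "(if i \<in> J then coordinate b i y else 0) =
        (if i \<in> J then coordinate b i (blinfun_apply A h) else 0)" for i
      using v by (auto dest: fun_cong[of _ _ i])
    then have "coordinate_projection b J y = coordinate_projection b J (blinfun_apply A h)"
      unfolding coordinate_projection_def by simp
    then show "coordinate_projection b J y \<in> range (coordinate_projection b J \<circ> blinfun_apply A)"
      by auto
  qed
qed

section \<open>Existence of Lagrange multipliers\<close>

theorem proposition8p6:
  fixes f0 :: "'e::banach \<Rightarrow> real"
    and G :: "'e \<Rightarrow> 'f::{real_inner, banach}"
    and b :: "nat \<Rightarrow> 'f"
    and g :: "nat \<Rightarrow> 'e \<Rightarrow> real"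
    and x0 :: 'e
    and V :: "'e set"
  assumes "schauder_basis UNIV b UNIV"
    and "besselian UNIV b UNIV"
    and "hilbertian UNIV b UNIV"
    and "class_C1 f0"
    and "class_C1 G"
    and "\<And>i. g i = biorthogonal UNIV b UNIV i \<circ> G"
    and "local_minimizer f0 (feasible_set UNIV g) x0"
    and "CRC_plus b UNIV g x0 V"
  shows "lagrange_multipliers f0 G {0} x0 \<noteq> {} \<and>
    (\<exists>\<mu>::'f. fderiv f0 x0 + adjoint_op (fderiv G x0) \<mu> = 0)"
proof -
  note bh = assms(2,3)
  note derG = class_C1_has_derivative[OF assms(5)]
  note derf = class_C1_has_derivative[OF assms(4)]
  interpret c: bounded_linear "coordinate b i" for i
    using assms(1) by (rule bounded_linear_coordinate)
  have derg: "(g i has_derivative (\<lambda>h. coordinate b i (blinfun_apply (fderiv G x) h))) (at x)" for i x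
    unfolding assms(6) comp_def by (rule c.has_derivative[OF derG])
  have fderiv_g: "blinfun_apply (fderiv (g i) x) h = coordinate b i (blinfun_apply (fderiv G x) h)" for i x h
    using fderiv_eqI[OF derg] by (rule fun_cong)
  obtain J where x0V: "x0 \<in> interior V"
    and basis: "\<And>x. x \<in> V \<Longrightarrow>
      schauder_basis J (\<lambda>i. fderiv (g i) x) (closure (span (range (\<lambda>i. fderiv (g i) x))))"
    and closed: "closedin (Metric_space.mtopology (Y_space b J) (Y_dist b J))
      (range (\<lambda>e i. if i \<in> J then blinfun_apply (fderiv (g i) x0) e else 0))"
    and evaluation: "\<And>i. i \<in> J \<Longrightarrow> \<exists>e. \<forall>\<phi>\<in>closure (span (range (\<lambda>i. fderiv (g i) x0))).
      biorthogonal J (\<lambda>i. fderiv (g i) x0) (closure (span (range (\<lambda>i. fderiv (g i) x0)))) i \<phi>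
        = blinfun_apply \<phi> e"
    using assms(8) unfolding CRC_plus_def Let_def by blast
  define P where "P = Blinfun (coordinate_projection b J)"
  have P: "blinfun_apply P = coordinate_projection b J"
    unfolding P_def by (rule bounded_linear_Blinfun_apply[OF bounded_linear_coordinate_projection[OF bh]])
  have coordP: "coordinate b i (blinfun_apply P y) = (if i \<in> J then coordinate b i y else 0)" for i y
    unfolding P by (rule coordinate_of_projection[OF bh])
  have idem: "blinfun_apply P (blinfun_apply P y) = blinfun_apply P y" for y
    by (rule coordinates_eqI[OF assms(1)]) (simp add: coordP)
  \<comment> \<open>\<open>p\<close> collects the constraints with index in \<open>J\<close>.\<close>
  define p where "p x = blinfun_apply P (G x)" for x
  define p' where "p' x = P o\<^sub>L fderiv G x" for x
  have derp: "(p has_derivative blinfun_apply (p' x)) (at x)" for x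
    using bounded_linear.has_derivative[OF blinfun.bounded_linear_right[of P] derG]
    by (simp add: p_def[abs_def] p'_def blinfun_compose.rep_eq comp_def blinfun.bilinear_simps)
  have onto: "range (blinfun_apply P) \<subseteq> range (blinfun_apply (p' x0))"
    using constraint_coordinates_surjective[OF bh fderiv_g basis closed evaluation] x0V interior_subset
    by (auto simp: p'_def P blinfun_compose.rep_eq)
  then obtain K where K: "K > 0"
    and lift: "\<And>y. \<exists>h. blinfun_apply (p' x0) h = blinfun_apply P y \<and> norm h \<le> K * norm y"
    using bounded_lifting[OF blinfun.bounded_linear_right blinfun.bounded_linear_right] by blast
  have G0: "G x0 = 0"
    using assms(7) by (intro coordinates_eqI[OF assms(1)])
      (simp add: local_minimizer_def feasible_set_def assms(6) c.zero)
  have p0: "p x0 = 0"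
    by (simp add: p_def G0 blinfun.zero_right)
  obtain U where U: "open U" "x0 \<in> U" and minimal: "\<And>x. x \<in> U \<Longrightarrow> (\<And>i. g i x = 0) \<Longrightarrow> f0 x0 \<le> f0 x"
    using assms(7) by (auto simp: local_minimizer_def feasible_set_def)
  \<comment> \<open>The correction constant will be \<open>2 * K\<close>, so this is what following the fibre of \<open>p\<close> demands.\<close>
  define \<epsilon> where "\<epsilon> = 1 / (24 * K)"
  have \<epsilon>: "\<epsilon> > 0" "\<epsilon> * K \<le> 1 / 4" "2 * K * \<epsilon> \<le> 1 / 12"
    using K by (simp_all add: \<epsilon>_def)
  have "\<forall>\<^sub>F x in nhds x0. x \<in> interior V \<and> x \<in> U \<and> norm (fderiv f0 x - fderiv f0 x0) < 1 \<and>
      norm (fderiv G x - fderiv G x0) < \<epsilon> / (norm P + 1)"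
    using x0V U \<epsilon>(1)
    by (intro eventually_conj eventually_nhds_in_open class_C1_near assms)
      (auto simp: add_nonneg_pos)
  then obtain r where r: "r > 0" and "\<And>x. x \<in> ball x0 r \<Longrightarrow> x \<in> interior V \<and> x \<in> U \<and>
      norm (fderiv f0 x - fderiv f0 x0) < 1 \<and> norm (fderiv G x - fderiv G x0) < \<epsilon> / (norm P + 1)"
    unfolding eventually_nhds_metric by (auto simp: dist_commute)
  then have rV: "\<And>x. x \<in> ball x0 r \<Longrightarrow> x \<in> V" and rU: "\<And>x. x \<in> ball x0 r \<Longrightarrow> x \<in> U"
    and rf: "\<And>x. x \<in> ball x0 r \<Longrightarrow> norm (fderiv f0 x - fderiv f0 x0) < 1"
    and rG: "\<And>x. x \<in> ball x0 r \<Longrightarrow> norm (fderiv G x - fderiv G x0) < \<epsilon> / (norm P + 1)"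
    using interior_subset by blast+
  have close: "norm (p' x - p' x0) \<le> \<epsilon>" if "x \<in> ball x0 r" for x
  proof -
    have "p' x - p' x0 = P o\<^sub>L (fderiv G x - fderiv G x0)"
      by (rule blinfun_eqI) (simp add: p'_def blinfun.bilinear_simps)
    then have "norm (p' x - p' x0) \<le> norm P * norm (fderiv G x - fderiv G x0)"
      using norm_blinfun_compose by metis
    also have "\<dots> \<le> (norm P + 1) * (\<epsilon> / (norm P + 1))"
      using rG[OF that] by (intro mult_mono) auto
    also have "\<dots> = \<epsilon>"
      by (simp add: add_nonneg_eq_0_iff)
    finally show ?thesis .
  qed
  have contp: "isCont p x" for x
    using derp by (rule has_derivative_continuous)
  have "isCont (\<lambda>z. dist x0 z + 2 * K * norm (p z)) x0"
    by (intro continuous_intros contp)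
  then have "((\<lambda>z. dist x0 z + 2 * K * norm (p z)) \<longlongrightarrow> 0) (nhds x0)"
    using tendsto_at_iff_tendsto_nhds[of "\<lambda>z. dist x0 z + 2 * K * norm (p z)" x0]
    by (simp add: isCont_def p0)
  then have "\<forall>\<^sub>F z in nhds x0. dist x0 z + 2 * K * norm (p z) < r"
    using r by (rule order_tendstoD(2))
  then obtain \<rho> where \<rho>: "\<rho> > 0"
    and small: "\<And>z. z \<in> ball x0 \<rho> \<Longrightarrow> dist x0 z + 2 * K * norm (p z) < r"
    unfolding eventually_nhds_metric by (auto simp: dist_commute)
  have sub: "z \<in> ball x0 r" if "z \<in> ball x0 \<rho>" for z
    using small[OF that] K by (smt (verit) mem_ball mult_nonneg_nonneg norm_ge_zero)
  have regular: "\<exists>z'. p z' = 0 \<and> dist z z' \<le> 2 * K * norm (p z)" if "z \<in> ball x0 \<rho>" for z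
  proof (rule metric_regularity[OF derp close _ K \<epsilon>(2) small[OF that]])
    show "\<exists>h. blinfun_apply (p' x0) h = p x \<and> norm h \<le> K * norm (p x)" for x
      using lift[of "p x"] by (simp add: p_def idem)
  qed
  have "continuous_on UNIV p"
    using contp by (simp add: continuous_on_eq_continuous_at)
  \<comment> \<open>Near \<open>x0\<close>, the constraints with index outside \<open>J\<close> are consequences of those in \<open>J\<close>.\<close>
  have feasible: "g i y = 0" if y: "y \<in> ball x0 (\<rho> / 2)" "p y = 0" for y i
  proof -
    have "g i x0 = g i y"
    proof (rule constant_on_fibre[OF \<open>continuous_on UNIV p\<close> _ derp _ regular _ \<epsilon>(1,3)])
      show "continuous_on UNIV (g i)"
        using has_derivative_continuous[OF derg] by (simp add: continuous_on_eq_continuous_at)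
      show "norm (p' x - p' x0) \<le> \<epsilon>" if "x \<in> ball x0 \<rho>" for x
        using that by (intro close sub)
      show "dist x0 y + dist x0 y < \<rho>"
        using y by simp
      fix z and \<eta> :: real assume z: "z \<in> ball x0 \<rho>" "p z = 0" and "\<eta> > 0"
      have "\<exists>M. \<forall>h. \<bar>blinfun_apply (fderiv (g i) z) h\<bar> \<le> M * norm (blinfun_apply (p' z) h) + \<eta> * norm h"
        if "\<eta> > 0" for \<eta>
      proof (rule dominated_by_basis[OF basis[OF rV[OF sub[OF z(1)]]] _ _ that])
        show "fderiv (g i) z \<in> closure (span (range (\<lambda>i. fderiv (g i) z)))"
          by (intro subsetD[OF closure_subset] span_base) simp
        fix j assume "j \<in> J"
        then have "blinfun_apply (fderiv (g j) z) h = coordinate b j (blinfun_apply (p' z) h)" for h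
          by (simp add: fderiv_g p'_def coordP)
        then show "\<exists>C. \<forall>h. \<bar>blinfun_apply (fderiv (g j) z) h\<bar> \<le> C * norm (blinfun_apply (p' z) h)"
          using c.bounded[of j] by (metis mult.commute real_norm_def)
      qed
      from stationary_along_fibre[OF derp derg[unfolded fderiv_g[symmetric]] this \<open>\<eta> > 0\<close>] z(2)
      show "\<exists>\<delta>>0. \<forall>w. p w = 0 \<longrightarrow> dist z w < \<delta> \<longrightarrow> dist (g i z) (g i w) \<le> \<eta> * dist z w"
        by simp
    qed (use K p0 y in auto)
    moreover have "g i x0 = 0"
      by (simp add: assms(6) G0 c.zero)
    ultimately show ?thesis
      by simp
  qed
  define L where "L = norm (fderiv f0 x0) + 1"
  have lipschitz: "L-lipschitz_on (ball x0 (\<rho> / 2)) f0"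
  proof (rule lipschitz_onI)
    fix x y assume "x \<in> ball x0 (\<rho> / 2)" "y \<in> ball x0 (\<rho> / 2)"
    moreover have "onorm (blinfun_apply (fderiv f0 z)) \<le> L" if "z \<in> ball x0 (\<rho> / 2)" for z
    proof -
      have "z \<in> ball x0 r"
        using that \<rho> by (intro sub) simp
      from rf[OF this] show ?thesis
        using norm_triangle_sub[of "fderiv f0 z" "fderiv f0 x0"] by (simp add: L_def norm_blinfun.rep_eq)
    qed
    ultimately have "norm (f0 x - f0 y) \<le> L * norm (x - y)"
      by (intro differentiable_bound[OF convex_ball has_derivative_at_withinI[OF derf]])
    then show "dist (f0 x) (f0 y) \<le> L * dist x y"
      by (simp add: dist_norm)
  qed (simp add: L_def)
  have "\<bar>blinfun_apply (fderiv f0 x0) h\<bar> \<le> L * (2 * K) * norm (blinfun_apply (p' x0) h)" for h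
  proof (rule minimizer_derivative_dominated[OF derp p0 derf lipschitz])
    show "f0 x0 \<le> f0 z" if "z \<in> ball x0 (\<rho> / 2)" "p z = 0" for z
      using that \<rho> by (intro minimal rU sub feasible) auto
    show "\<exists>z'. p z' = 0 \<and> dist z z' \<le> 2 * K * norm (p z)" if "z \<in> ball x0 (\<rho> / 2)" for z
      using that \<rho> by (intro regular) simp
  qed (use \<rho> K in auto)
  then obtain \<nu> where \<nu>: "\<And>h. blinfun_apply (fderiv f0 x0) h = inner \<nu> (blinfun_apply (fderiv G x0) h)"
    using dominated_functional_representation[of "blinfun_apply (fderiv G x0)" "blinfun_apply P"
        "blinfun_apply (fderiv f0 x0)"] onto
    by (auto simp: p'_def blinfun_compose.rep_eq comp_def blinfun.bounded_linear_right bounded_linear.linear)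
  have "fderiv f0 x0 + adjoint_op (fderiv G x0) (- \<nu>) = 0"
    by (rule blinfun_eqI) (simp add: adjoint_op_def \<nu> blinfun.bilinear_simps blinfun_inner_right.rep_eq)
  moreover have "- \<nu> \<in> lagrange_multipliers f0 G {0} x0"
  proof -
    have "((\<lambda>x. lagrangian f0 G x (- \<nu>)) has_derivative
        (\<lambda>h. blinfun_apply (fderiv f0 x0) h + inner (- \<nu>) (blinfun_apply (fderiv G x0) h))) (at x0)"
      unfolding lagrangian_def by (intro has_derivative_add derf has_derivative_inner_right derG)
    from fderiv_eqI[OF this] have "fderiv (\<lambda>x. lagrangian f0 G x (- \<nu>)) x0 = 0"
      by (intro blinfun_eqI) (simp add: \<nu>)
    then show ?thesis
      by (simp add: lagrange_multipliers_def normal_cone_def G0)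
  qed
  ultimately show ?thesis
    by blast
qed

end
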